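(* Let $T$ be a tree of diameter $5$ with vertex set $V(T)=\{v_1,v_2,\ldots,v_n\}$, labelled so that $v_1$ and $v_2$ are its two central vertices, let $s_1,s_2,\ldots,s_n$ be integers with $s_i\ge 2$ for all $i=1,\ldots,n$, and let $G:=T(s_1,s_2,\ldots,s_n)$ be the corresponding vertex-multiplication. For $k=1,2$ let $NL_k$ be the set of vertices of $T$ that are neighbours of $v_k$, different from $v_{3-k}$, and not end-vertices (leaves) of $T$, and let $m_k:=\min\{s_u \mid u\in NL_k\}$, where $s_u$ denotes the integer $s_i$ with $u=v_i$. Then the following hold. (1) If $s_i\ge 3$ for some $i\in\{1,2\}$, then $G\in\mathscr{C}_0$. (2) If $m_1\ge 4$ and $m_2\ge 4$, then $G\in\mathscr{C}_0$. (3) If $s_1=s_2=2$ and $2\le m_i\le 3$ for some $i\in\{1,2\}$, then $G\in\mathscr{C}_0$ if and only if $|NL_k|=1$ for some $k\in\{1,2\}$.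
   Context: Graphs are finite, with no loops or parallel edges. For a connected graph $G$ with vertex set $\{v_1,\ldots,v_n\}$ and positive integers $s_1,\ldots,s_n$, the $G$ vertex-multiplication $G(s_1,\ldots,s_n)$ is the graph with vertex set $\bigcup_{i=1}^n V_i$, where the $V_i$ are pairwise disjoint sets with $|V_i|=s_i$, in which $x\in V_i$ and $y\in V_j$ are adjacent if and only if $i\ne j$ and $v_iv_j\in E(G)$. An orientation of a graph is a digraph obtained by assigning a direction to every edge; it is strong if every two vertices are mutually reachable by directed paths. In a graph or digraph, the distance from $v$ to $x$ is the length of a shortest (directed) path from $v$ to $x$ ($\infty$ if none exists), and the diameter $d(\cdot)$ is the maximum of the distances over all ordered pairs of vertices. For a connected bridgeless graph $G$, the orientation number is $\bar d(G):=\min\{d(D)\mid D \text{ is a strong orientation of } G\}$. For a connected parent graph $G$ of order $n\ge 3$ and $s_i\ge 2$ for all $i$, one writes $G(s_1,\ldots,s_n)\in\mathscr{C}_j$ if $\bar d(G(s_1,\ldots,s_n))=d(G)+j$, for $j=0,1,2$. Thus for a tree $T$ of diameter $5$, $T(s_1,\ldots,s_n)\in\mathscr{C}_0$ means $\bar d(T(s_1,\ldots,s_n))=5$. A tree of diameter $5$ has exactly two central vertices, i.e. vertices of eccentricity equal to the radius $3$, and they are adjacent. The sets $NL_1,NL_2$ are always nonempty, so $m_1,m_2$ are well defined. *)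

theory Defs
  imports "Graph_Theory.Graph_Theory" "HOL-Library.Extended_Nat"
begin

text \<open>
  An undirected graph is a symmetric digraph whose arcs are pairs of vertices
  (locale \<^locale>\<open>pair_graph\<close>: finite, loopless); an edge between \<open>u\<close> and \<open>v\<close> is the pair of
  arcs \<open>(u, v)\<close> and \<open>(v, u)\<close>. Directed walks of such a digraph are the walks of the graph, so the
  notions of distance, eccentricity and diameter below serve graphs and digraphs alike.
\<close>

definition gdist :: "'a pair_pre_digraph \<Rightarrow> 'a \<Rightarrow> 'a \<Rightarrow> enat" where
  "gdist G u v = (INF p \<in> {p. pre_digraph.apath (with_proj G) u p v}. enat (length p))"

definition gdiameter :: "'a pair_pre_digraph \<Rightarrow> enat" where
  "gdiameter G = (SUP (u, v) \<in> pverts G \<times> pverts G. gdist G u v)"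

definition eccentricity :: "'a pair_pre_digraph \<Rightarrow> 'a \<Rightarrow> enat" where
  "eccentricity G u = (SUP v \<in> pverts G. gdist G u v)"

definition gradius :: "'a pair_pre_digraph \<Rightarrow> enat" where
  "gradius G = (INF u \<in> pverts G. eccentricity G u)"

definition central_vertices :: "'a pair_pre_digraph \<Rightarrow> 'a set" where
  "central_vertices G = {u \<in> pverts G. eccentricity G u = gradius G}"

text \<open>
  In a symmetric digraph, going back and forth along one edge counts as a directed cycle (of
  length 2), so \<^const>\<open>Digraph_Component.tree\<close> admits no symmetric digraph with an edge. The
  cycles of the underlying undirected graph are the directed cycles of length at least 3.
\<close>

definition tree_graph :: "'a pair_pre_digraph \<Rightarrow> bool" where
  "tree_graph T \<longleftrightarrow> pair_graph T \<and> Digraph_Component.connected (with_proj T) \<and>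
     \<not> (\<exists>p. pre_digraph.cycle (with_proj T) p \<and> 3 \<le> length p)"

text \<open>
  The out-degree of a vertex in a symmetric digraph is its degree in the undirected graph.
\<close>

definition end_vertex :: "'a pair_pre_digraph \<Rightarrow> 'a \<Rightarrow> bool" where
  "end_vertex G u \<longleftrightarrow> u \<in> pverts G \<and> out_degree (with_proj G) u = 1"

text \<open>
  The multiplicities are indexed by the vertices of \<open>G\<close> themselves; the class of copies
  of \<open>v\<close> is \<open>{v} \<times> {..<s v}\<close>.
\<close>

definition vertex_mult :: "'a pair_pre_digraph \<Rightarrow> ('a \<Rightarrow> nat) \<Rightarrow> ('a \<times> nat) pair_pre_digraph" where
  "vertex_mult G s =
     (let V = (SIGMA v : pverts G. {..<s v}) in
      \<lparr> pverts = V,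
        parcs = {(x, y). x \<in> V \<and> y \<in> V \<and> fst x \<noteq> fst y \<and> (fst x, fst y) \<in> parcs G} \<rparr>)"

definition orientation_of :: "'a pair_pre_digraph \<Rightarrow> 'a pair_pre_digraph \<Rightarrow> bool" where
  "orientation_of D G \<longleftrightarrow> pverts D = pverts G \<and> parcs D \<subseteq> parcs G \<and>
     (\<forall>(u, v) \<in> parcs G. ((u, v) \<in> parcs D) \<noteq> ((v, u) \<in> parcs D))"

text \<open>
  For a connected bridgeless graph the infimum is over a nonempty set and hence a minimum;
  it is \<open>\<infinity>\<close> if there is no strong orientation.
\<close>

definition orientation_number :: "'a pair_pre_digraph \<Rightarrow> enat" where
  "orientation_number G =
     (INF D \<in> {D. orientation_of D G \<and> strongly_connected (with_proj D)}. gdiameter D)"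

text \<open>
  \<open>vm_class j G s\<close> says that the vertex-multiplication of \<open>G\<close> by \<open>s\<close> belongs to the
  class \<open>C\<^sub>j\<close>; it is meant for connected \<open>G\<close> with at least 3 vertices and
  multiplicities at least 2.
\<close>

definition vm_class :: "nat \<Rightarrow> 'a pair_pre_digraph \<Rightarrow> ('a \<Rightarrow> nat) \<Rightarrow> bool" where
  "vm_class j G s \<longleftrightarrow> orientation_number (vertex_mult G s) = gdiameter G + enat j"

text \<open>
  With \<open>v\<close> and \<open>w\<close> the two central vertices, \<open>NL T v w\<close> and \<open>min_mult T s v w\<close> are the set
  \<open>NL\<^sub>k\<close> and the number \<open>m\<^sub>k\<close> belonging to \<open>v = v\<^sub>k\<close>.
\<close>

definition NL :: "'a pair_pre_digraph \<Rightarrow> 'a \<Rightarrow> 'a \<Rightarrow> 'a set" where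
  "NL T v w = {u. (v, u) \<in> parcs T \<and> u \<noteq> w \<and> \<not> end_vertex T u}"

definition min_mult :: "'a pair_pre_digraph \<Rightarrow> ('a \<Rightarrow> nat) \<Rightarrow> 'a \<Rightarrow> 'a \<Rightarrow> nat" where
  "min_mult T s v w = Min (s ` NL T v w)"

end

theory Submission
  imports Defs
begin

text \<open>
  Rooting the tree at a central vertex and numbering the vertices along longest paths by roles
  0 to 5 (leaf side of \<open>v1\<close> to leaf side of \<open>v2\<close>), every edge changes the role by 1. Hence any
  orientation has diameter at least 5, and membership in \<open>C\<^sub>0\<close> means that all distances are at most 5.

  Sufficiency: an orientation that depends only on roles and on a bounded class of the copy index
  is a homomorphic pull-back of a small digraph, whose walks through the centre lift; so
  it is enough to check finitely many pairs of nodes of that digraph.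

  Necessity: a walk of length at most 5 from a copy of role 1 to one of role 5 is monotone in the
  role. If \<open>v1\<close> and \<open>v2\<close> have only two copies each, every copy of role 1 therefore has exactly one
  out-neighbour above it, and when both \<open>NL\<close> sets have at least two elements both choices occur.
  This forces the copies of \<open>v1\<close> and \<open>v2\<close> into a directed 4-cycle, and then a leaf of role 5 needs
  in-neighbours and out-neighbours of both kinds, i.e. four copies of its neighbour.
\<close>

section \<open>Walks and distances\<close>

text \<open>A walk that repeats a vertex contains a nonempty closed subwalk; cutting it out and
  iterating ends in a path.\<close>

lemma (in pair_wf_digraph) apath_le_of_awalk:
  assumes "awalk u p v"
  shows "\<exists>q. apath u q v \<and> length q \<le> length p"
  using assms
proof (induction "length p" arbitrary: p rule: less_induct)
  case less
  show ?case
  proof (cases "distinct (awalk_verts u p)")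
    case True
    then show ?thesis
      using less.prems by (auto simp: apath_def)
  next
    case False
    then obtain q r t w where *: "p = q @ r @ t" "0 < length r" "awalk u q w" "awalk w t v"
      using awalk_not_distinct_decomp[OF less.prems] by auto
    then have "awalk u (q @ t) v" "length (q @ t) < length p"
      by (auto intro: awalk_appendI)
    then show ?thesis
      using less.hyps[of "q @ t"] by fastforce
  qed
qed

lemma (in pair_wf_digraph) relpow_imp_awalk:
  assumes "(u, v) \<in> parcs G ^^ k" "u \<in> pverts G"
  shows "\<exists>p. awalk u p v \<and> length p = k \<and> set p \<subseteq> parcs G"
  using assms
proof (induction k arbitrary: u)
  case 0
  then show ?case by (auto simp: awalk_Nil_iff intro!: exI[of _ "[]"])
next
  case (Suc k)
  then obtain w where w: "(u, w) \<in> parcs G" "(w, v) \<in> parcs G ^^ k"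
    by (meson relpow_Suc_D2)
  then obtain p where "awalk w p v" "length p = k" "set p \<subseteq> parcs G"
    using Suc.IH in_arcsD2 by blast
  then have "awalk u ((u, w) # p) v \<and> length ((u, w) # p) = Suc k \<and> set ((u, w) # p) \<subseteq> parcs G"
    using w in_arcsD1 by (auto simp: awalk_Cons_iff)
  then show ?case by blast
qed

lemma (in pair_wf_digraph) awalk_imp_relpow:
  assumes "awalk u p v"
  shows "(u, v) \<in> parcs G ^^ length p"
  using assms
proof (induction p arbitrary: u)
  case Nil
  then show ?case by (simp add: awalk_Nil_iff)
next
  case (Cons e p)
  then have "e \<in> parcs G" "fst e = u" "awalk (snd e) p v"
    by (auto simp: awalk_Cons_iff)
  then show ?case
    using Cons.IH relpow_Suc_I2[of u "snd e"] by (metis length_Cons prod.collapse)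
qed

text \<open>An infimum over a nonempty set in \<open>enat\<close> is attained, and walks shorten to
  paths. From here on distances are handled through powers of the arc relation.\<close>

lemma (in pair_wf_digraph) gdist_le_iff:
  assumes "u \<in> pverts G"
  shows "gdist G u v \<le> enat k \<longleftrightarrow> (\<exists>j\<le>k. (u, v) \<in> parcs G ^^ j)"
proof
  let ?S = "(\<lambda>p. enat (length p)) ` {p. apath u p v}"
  assume le: "gdist G u v \<le> enat k"
  then have "Inf ?S \<noteq> \<infinity>"
    unfolding gdist_def by (metis infinity_ileE)
  then have "?S \<noteq> {}"
    by (metis Inf_empty top_enat_def)
  then obtain l where "l \<in> ?S" by blast
  then have "Inf ?S \<in> ?S"
    by (rule wellorder_InfI)
  then obtain p where "apath u p v" "enat (length p) \<le> enat k"
    using le unfolding gdist_def by auto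
  then show "\<exists>j\<le>k. (u, v) \<in> parcs G ^^ j"
    using awalk_imp_relpow by (auto simp: apath_def)
next
  assume "\<exists>j\<le>k. (u, v) \<in> parcs G ^^ j"
  then obtain p where "awalk u p v" "length p \<le> k"
    using relpow_imp_awalk assms by blast
  then obtain q where "apath u q v" "length q \<le> k"
    using apath_le_of_awalk by (meson order_trans)
  then show "gdist G u v \<le> enat k"
    unfolding gdist_def by (intro INF_lower2[of q]) auto
qed

lemma (in pair_wf_digraph) gdiameter_le_iff:
  "gdiameter G \<le> enat k \<longleftrightarrow>
     (\<forall>u\<in>pverts G. \<forall>v\<in>pverts G. \<exists>j\<le>k. (u, v) \<in> parcs G ^^ j)"
  by (auto simp: gdiameter_def SUP_le_iff gdist_le_iff)

lemma (in pair_wf_digraph) eccentricity_le_iff: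
  assumes "u \<in> pverts G"
  shows "eccentricity G u \<le> enat k \<longleftrightarrow> (\<forall>v\<in>pverts G. \<exists>j\<le>k. (u, v) \<in> parcs G ^^ j)"
  by (simp add: eccentricity_def SUP_le_iff gdist_le_iff assms)

lemma relpow_trans:
  "(x, y) \<in> r ^^ m \<Longrightarrow> (y, z) \<in> r ^^ n \<Longrightarrow> (x, z) \<in> r ^^ (m + n)"
  by (auto simp: relpow_add)

lemma relpow_sym:
  assumes "sym r" "(x, y) \<in> r ^^ n"
  shows "(y, x) \<in> r ^^ n"
  using assms(2)
proof (induction n arbitrary: y)
  case (Suc n)
  then obtain z where z: "(x, z) \<in> r ^^ n" "(z, y) \<in> r" by auto
  from relpow_Suc_I2[OF symD[OF assms(1) z(2)] Suc.IH[OF z(1)]] show ?case .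
qed simp

section \<open>Edges of a tree as bridges, and connectedness\<close>

text \<open>A path from \<open>y\<close> to \<open>x\<close> avoiding the edge has length at least
  2, so with the arc \<open>(x, y)\<close> it closes up to a cycle of length at least 3.\<close>

lemma tree_graph_bridge:
  assumes "tree_graph T" "(x, y) \<in> parcs T"
  shows "(y, x) \<notin> (parcs T - {(x, y), (y, x)})\<^sup>*"
proof
  assume walk: "(y, x) \<in> (parcs T - {(x, y), (y, x)})\<^sup>*"
  interpret T: pair_graph T
    using assms(1) by (simp add: tree_graph_def)
  let ?H = "\<lparr>pverts = pverts T, parcs = parcs T - {(x, y), (y, x)}\<rparr>"
  interpret H: pair_wf_digraph ?H
    by unfold_locales (auto dest: T.in_arcsD1 T.in_arcsD2)
  have "y \<in> pverts T" "x \<in> pverts T" "x \<noteq> y"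
    using assms(2) T.in_arcsD1 T.in_arcsD2 T.no_loops' by auto
  obtain k where "(y, x) \<in> parcs ?H ^^ k"
    using rtrancl_imp_relpow[OF walk] by auto
  then obtain p0 where "H.awalk y p0 x"
    using H.relpow_imp_awalk[of y x k] \<open>y \<in> pverts T\<close> by auto
  then obtain p where p: "H.apath y p x"
    using H.apath_le_of_awalk by blast
  then have cas: "pcas y p x" and sub: "set p \<subseteq> parcs T - {(x, y), (y, x)}"
    and dist: "distinct (pawalk_verts y p)"
    by (auto simp: H.apath_def H.awalk_def)
  have "p \<noteq> []"
    using cas \<open>x \<noteq> y\<close> by auto
  moreover have "length p \<noteq> 1"
    using cas sub by (auto simp: length_Suc_conv)
  ultimately have "2 \<le> length p"
    by (cases "length p") auto
  have "T.awalk x ((x, y) # p) x"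
    using cas sub assms(2) \<open>x \<in> pverts T\<close> \<open>y \<in> pverts T\<close>
    by (auto simp: T.awalk_Cons_iff T.awalk_def)
  then have "T.cycle ((x, y) # p)"
    using dist by (auto simp: T.cycle_def)
  then show False
    using assms(1) \<open>2 \<le> length p\<close> by (auto simp: tree_graph_def)
qed

lemma tree_graph_connected:
  assumes "tree_graph T" "u \<in> pverts T" "v \<in> pverts T"
  shows "(u, v) \<in> (parcs T)\<^sup>*"
proof -
  interpret T: pair_graph T
    using assms(1) by (simp add: tree_graph_def)
  have "parcs (mk_symmetric (with_proj T)) \<subseteq> parcs T"
    using T.arcs_symmetric by (auto simp: mk_symmetric_def)
  moreover have "(u, v) \<in> rtrancl_on (pverts T) (parcs (mk_symmetric (with_proj T)))"
    using assms by (auto simp: tree_graph_def connected_def strongly_connected_def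
        reachable_def mk_symmetric_def)
  ultimately show ?thesis
    by (meson rtrancl_mono rtrancl_on_rtranclI subsetD)
qed

section \<open>Trees of diameter 5\<close>

locale rooted_tree = pair_graph T for T :: "'a pair_pre_digraph" +
  fixes root :: 'a
  assumes tree: "tree_graph T" and root: "root \<in> pverts T"
begin

definition depth :: "'a \<Rightarrow> nat" where
  "depth x = (LEAST k. (x, root) \<in> parcs T ^^ k)"

definition parent :: "'a \<Rightarrow> 'a" where
  "parent x = (SOME y. (x, y) \<in> parcs T \<and> depth y < depth x)"

text \<open>The ancestor at depth 1, naming the component of the tree minus its root. At the root,
  truncated subtraction makes the value the root itself.\<close>

definition branch :: "'a \<Rightarrow> 'a" where
  "branch x = (parent ^^ (depth x - 1)) x"

lemma sym_parcs: "sym (parcs T)"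
  using arcs_symmetric by (auto intro: symI)

lemma depth_relpow: "x \<in> pverts T \<Longrightarrow> (x, root) \<in> parcs T ^^ depth x"
  unfolding depth_def
  using tree_graph_connected[OF tree _ root] rtrancl_imp_relpow by (metis LeastI)

lemma depth_le: "(x, root) \<in> parcs T ^^ k \<Longrightarrow> depth x \<le> k"
  unfolding depth_def by (rule Least_le)

lemma depth_root [simp]: "depth root = 0"
  using depth_le[of root 0] by simp

lemma depth_eq_0: "x \<in> pverts T \<Longrightarrow> depth x = 0 \<longleftrightarrow> x = root"
  using depth_relpow[of x] by fastforce

lemma depth_step: "(x, y) \<in> parcs T \<Longrightarrow> depth x \<le> Suc (depth y)"
  using depth_le[OF relpow_Suc_I2] depth_relpow in_arcsD2 by blast

lemma ex_depth_pred:
  assumes "x \<in> pverts T" "x \<noteq> root"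
  shows "\<exists>y. (x, y) \<in> parcs T \<and> Suc (depth y) = depth x"
proof -
  obtain k where k: "depth x = Suc k"
    using depth_eq_0[OF assms(1)] assms(2) by (cases "depth x") auto
  then obtain y where y: "(x, y) \<in> parcs T" "(y, root) \<in> parcs T ^^ k"
    using depth_relpow[OF assms(1)] by (metis relpow_Suc_D2)
  then have "depth y = k"
    using depth_le[OF y(2)] depth_step[OF y(1)] k by simp
  with y(1) k show ?thesis
    by auto
qed

text \<open>Each step goes to a neighbour of smaller depth. The relation records which arcs can
  occur, so that the walk can be seen to avoid a given edge.\<close>

lemma descent:
  assumes "x \<in> pverts T"
  shows "(x, root) \<in> {(a, b) \<in> parcs T. (a = x \<or> depth a < depth x) \<and> depth b < depth a}\<^sup>*"
  using assms
proof (induction "depth x" arbitrary: x rule: less_induct)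
  case less
  show ?case
  proof (cases "x = root")
    case False
    then obtain y where y: "(x, y) \<in> parcs T" "Suc (depth y) = depth x"
      using ex_depth_pred less.prems by blast
    let ?D = "\<lambda>x. {(a, b) \<in> parcs T. (a = x \<or> depth a < depth x) \<and> depth b < depth a}"
    have "(y, root) \<in> (?D y)\<^sup>*"
      using less.hyps[of y] y in_arcsD2 by auto
    moreover have "?D y \<subseteq> ?D x"
      using y(2) by auto
    ultimately have "(y, root) \<in> (?D x)\<^sup>*"
      using rtrancl_mono by blast
    moreover have "(x, y) \<in> ?D x"
      using y by auto
    ultimately show ?thesis
      by (rule converse_rtrancl_into_rtrancl[rotated])
  qed simp
qed

text \<open>If \<open>y\<close> and \<open>z\<close> differ, descending from both to the root avoids
  the edge between \<open>x\<close> and \<open>y\<close>; then \<open>y\<close> reaches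
  \<open>x\<close> via the root and \<open>z\<close> without that edge, although it is a
  bridge.\<close>

lemma lower_neighbour_unique:
  assumes "(x, y) \<in> parcs T" "(x, z) \<in> parcs T" "depth y \<le> depth x" "depth z \<le> depth x"
  shows "y = z"
proof (rule ccontr)
  assume "y \<noteq> z"
  let ?R = "parcs T - {(x, y), (y, x)}"
  let ?D = "\<lambda>x. {(a, b) \<in> parcs T. (a = x \<or> depth a < depth x) \<and> depth b < depth a}"
  have "x \<noteq> y" "x \<noteq> z"
    using assms no_loops' by auto
  have "?D y \<subseteq> ?R" "?D z \<subseteq> ?R"
    using assms(3,4) \<open>x \<noteq> y\<close> \<open>x \<noteq> z\<close> by auto
  then have y: "(y, root) \<in> ?R\<^sup>*" and z: "(z, root) \<in> ?R\<^sup>*"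
    using descent[of y] descent[of z] assms(1,2) in_arcsD2 rtrancl_mono by blast+
  have "sym ?R"
    using sym_parcs by (auto simp: sym_def)
  then have "(root, z) \<in> ?R\<^sup>*"
    using z by (meson sym_rtrancl symD)
  moreover have "(z, x) \<in> ?R"
    using assms(2) arcs_symmetric \<open>y \<noteq> z\<close> \<open>x \<noteq> z\<close> by auto
  ultimately have "(y, x) \<in> ?R\<^sup>*"
    using y by (meson rtrancl_trans rtrancl_into_rtrancl)
  then show False
    using tree_graph_bridge[OF tree assms(1)] by blast
qed

lemma
  assumes "x \<in> pverts T" "x \<noteq> root"
  shows parent_arc: "(x, parent x) \<in> parcs T"
    and depth_parent: "Suc (depth (parent x)) = depth x"
proof -
  obtain y where y: "(x, y) \<in> parcs T" "Suc (depth y) = depth x"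
    using ex_depth_pred[OF assms] by blast
  have "(x, parent x) \<in> parcs T \<and> depth (parent x) < depth x"
    unfolding parent_def by (rule someI[of _ y]) (use y in auto)
  moreover from this have "parent x = y"
    using lower_neighbour_unique[of x "parent x" y] y by simp
  ultimately show "(x, parent x) \<in> parcs T" "Suc (depth (parent x)) = depth x"
    using y by auto
qed

text \<open>Of two adjacent vertices, the one that is not deeper is the parent of the other by
  uniqueness; this also rules out edges within one depth level.\<close>

lemma arc_iff_parent:
  "(x, y) \<in> parcs T \<longleftrightarrow>
     x \<in> pverts T \<and> y \<in> pverts T \<and> (x \<noteq> root \<and> y = parent x \<or> y \<noteq> root \<and> x = parent y)"
proof -
  have down: "x \<noteq> root \<and> y = parent x" if "(x, y) \<in> parcs T" "depth y \<le> depth x" for x y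
  proof -
    have V: "x \<in> pverts T" "y \<in> pverts T"
      using that in_arcsD1 in_arcsD2 by auto
    have "x \<noteq> root"
      using that V depth_eq_0[of y] no_loops' by fastforce
    then show ?thesis
      using lower_neighbour_unique[of x y "parent x"] parent_arc depth_parent[of x] that V by simp
  qed
  show ?thesis
    using down[of x y] down[of y x] parent_arc arcs_symmetric in_arcsD1 in_arcsD2
    by (meson nat_le_linear)
qed

lemma branch_parent:
  assumes "x \<in> pverts T" "x \<noteq> root" "parent x \<noteq> root"
  shows "branch (parent x) = branch x"
proof -
  have "parent x \<in> pverts T"
    using assms parent_arc in_arcsD2 by blast
  then have "depth (parent x) \<noteq> 0"
    using assms depth_eq_0 by blast
  then obtain d where "depth x = Suc (Suc d)" "depth (parent x) = Suc d"
    using depth_parent[OF assms(1,2)] by (cases "depth (parent x)") auto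
  then show ?thesis
    by (simp add: branch_def funpow_swap1)
qed

lemma branch_arc:
  assumes "(x, y) \<in> parcs T" "x \<noteq> root" "y \<noteq> root"
  shows "branch x = branch y"
  using assms branch_parent arc_iff_parent by metis

text \<open>Arcs that avoid the root stay in one branch, so the walk has to descend to the root and
  climb again.\<close>

lemma walk_between_branches:
  assumes "(x, y) \<in> parcs T ^^ k" "x \<in> pverts T" "y \<in> pverts T" "x \<noteq> root" "y \<noteq> root"
    "branch x \<noteq> branch y"
  shows "depth x + depth y \<le> k"
  using assms
proof (induction k arbitrary: x)
  case (Suc k)
  then obtain z where z: "(x, z) \<in> parcs T" "(z, y) \<in> parcs T ^^ k"
    by (meson relpow_Suc_D2)
  show ?case
  proof (cases "z = root")
    case True
    then have "depth y \<le> k" "depth x \<le> 1"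
      using depth_le relpow_sym[OF sym_parcs z(2)] depth_step[OF z(1)] by auto
    then show ?thesis by simp
  next
    case False
    then have "depth z + depth y \<le> k"
      using Suc.IH[OF z(2)] Suc.prems branch_arc[OF z(1)] in_arcsD2[OF z(1)] by simp
    then show ?thesis
      using depth_step[OF z(1)] by simp
  qed
qed auto

end

section \<open>Roles along a longest path\<close>

text \<open>The role of the next vertex towards \<open>c2\<close>: roles 0, 1, 2 count up to 3, and
  roles 5, 4 count down to 3.\<close>

definition up_role :: "nat \<Rightarrow> nat" where
  "up_role r = (if r < 3 then Suc r else r - 1)"

text \<open>
  A tree of diameter 5 with central vertices \<open>c1\<close> and \<open>c2\<close>, rooted at \<open>c2\<close>. The role of a vertex is
  its position on a longest path: 0 and 5 are the vertices at distance 2 from the nearer central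
  vertex (\<open>c1\<close> and \<open>c2\<close>, respectively), and 2 and 3 are the roles of \<open>c1\<close> and \<open>c2\<close>.
\<close>

locale bistar =
  fixes T :: "'a pair_pre_digraph" and c1 c2 :: 'a and role :: "'a \<Rightarrow> nat" and par :: "'a \<Rightarrow> 'a"
  assumes finite_verts: "finite (pverts T)"
    and centre_in: "c1 \<in> pverts T" "c2 \<in> pverts T"
    and role_le: "v \<in> pverts T \<Longrightarrow> role v \<le> 5"
    and role_eq_2: "v \<in> pverts T \<Longrightarrow> role v = 2 \<longleftrightarrow> v = c1"
    and role_eq_3: "v \<in> pverts T \<Longrightarrow> role v = 3 \<longleftrightarrow> v = c2"
    and par_in: "v \<in> pverts T \<Longrightarrow> v \<noteq> c2 \<Longrightarrow> par v \<in> pverts T"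
    and role_par: "v \<in> pverts T \<Longrightarrow> v \<noteq> c2 \<Longrightarrow> role (par v) = up_role (role v)"
    and arc_iff: "(u, v) \<in> parcs T \<longleftrightarrow> u \<in> pverts T \<and> v \<in> pverts T \<and>
      (u \<noteq> c2 \<and> v = par u \<or> v \<noteq> c2 \<and> u = par v)"
    and ex_role_0: "\<exists>v\<in>pverts T. role v = 0"
    and ex_role_5: "\<exists>v\<in>pverts T. role v = 5"

text \<open>Rooting at \<open>q\<close> puts \<open>u\<close> at depth 3 in the branch of
  \<open>p\<close> and \<open>w\<close> at depth 2 in another branch. Walks between branches are at
  least as long as the sum of the depths, so \<open>u\<close> bounds the depth outside the branch of
  \<open>p\<close> by 2, and \<open>w\<close> bounds it inside by 3.\<close>

lemma diameter_5_bistar: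
  assumes tree: "tree_graph T" and diam: "\<And>x y. x \<in> pverts T \<Longrightarrow> y \<in> pverts T \<Longrightarrow> \<exists>j\<le>5. (x, y) \<in> parcs T ^^ j"
    and path: "(u, p) \<in> parcs T ^^ 2" "(p, q) \<in> parcs T" "(q, w) \<in> parcs T ^^ 2"
    and far: "\<And>j. j < 5 \<Longrightarrow> (u, w) \<notin> parcs T ^^ j"
    and V: "u \<in> pverts T" "w \<in> pverts T"
  shows "\<forall>x\<in>pverts T. \<exists>j\<le>3. (x, q) \<in> parcs T ^^ j"
    and "\<exists>role par. bistar T p q role par"
proof -
  have pg: "pair_graph T"
    using tree by (simp add: tree_graph_def)
  interpret pg: pair_graph T by (rule pg)
  have pV: "p \<in> pverts T" "q \<in> pverts T"
    using path(2) pg.in_arcsD1 pg.in_arcsD2 by auto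
  interpret rooted_tree T q
    by unfold_locales (use tree pV in auto)
  have "p \<noteq> q"
    using path(2) pg.no_loops' by auto
  have short: "5 \<le> i + j" if "(u, x) \<in> parcs T ^^ i" "(x, w) \<in> parcs T ^^ j" for x i j
    using far[of "i + j"] relpow_trans[OF that] by fastforce
  have dw: "depth w = 2"
  proof -
    have "depth w \<le> 2"
      using depth_le relpow_sym[OF sym_parcs path(3)] by blast
    moreover have "(u, q) \<in> parcs T ^^ 3"
      using relpow_Suc_I[OF path(1,2)] by (simp add: numeral_3_eq_3)
    ultimately show ?thesis
      using short[of q 3 "depth w"] relpow_sym[OF sym_parcs depth_relpow[OF V(2)]] by simp
  qed
  have du: "depth u = 3"
    using short[OF depth_relpow[OF V(1)] path(3)] relpow_Suc_I[OF path(1,2)] depth_le[of u 3]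
    by (simp add: numeral_3_eq_3)
  have dp: "depth p = 1"
    using depth_step[OF path(2)] depth_eq_0[OF pV(1)] \<open>p \<noteq> q\<close> by simp
  then have [simp]: "branch p = p"
    by (simp add: branch_def)
  have "u \<noteq> q" "w \<noteq> q" using du dw by auto
  have bu: "branch u = p"
    using walk_between_branches[OF path(1) V(1) pV(1) \<open>u \<noteq> q\<close> \<open>p \<noteq> q\<close>] du dp by fastforce
  \<comment> \<open>Otherwise \<open>w\<close> would be adjacent to \<open>p\<close>, hence at
    distance at most 3 from \<open>u\<close>.\<close>
  have bw: "branch w \<noteq> p"
  proof
    assume "branch w = p"
    then have "parent w = p"
      using dw by (simp add: branch_def)
    then have "(p, w) \<in> parcs T ^^ 1"
      using parent_arc[OF V(2)] dw depth_eq_0[OF V(2)] pg.arcs_symmetric by force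
    then show False
      using short[OF path(1)] by fastforce
  qed
  have far_u: "depth x \<le> 2" if x: "x \<in> pverts T" "x \<noteq> q" "branch x \<noteq> p" for x
  proof -
    obtain j where j: "j \<le> 5" "(x, u) \<in> parcs T ^^ j"
      using diam[OF x(1) V(1)] by auto
    then show ?thesis
      using walk_between_branches[OF j(2) x(1) V(1) x(2) \<open>u \<noteq> q\<close>] x(3) du bu j(1) by simp
  qed
  have depth_3: "depth x \<le> 3" if x: "x \<in> pverts T" for x
  proof (cases "x = q \<or> branch x \<noteq> p")
    case True
    then show ?thesis using far_u[OF x] by force
  next
    case False
    obtain j where j: "j \<le> 5" "(x, w) \<in> parcs T ^^ j"
      using diam[OF x V(2)] by auto
    then show ?thesis
      using walk_between_branches[OF j(2) x V(2)] False \<open>w \<noteq> q\<close> dw bw j(1) by simp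
  qed
  show "\<forall>x\<in>pverts T. \<exists>j\<le>3. (x, q) \<in> parcs T ^^ j"
    using depth_3 depth_relpow by blast
  define role where
    "role x = (if x = q then 3 else if branch x = p then 3 - depth x else 3 + depth x)" for x
  have pos: "depth x > 0" if "x \<in> pverts T" "x \<noteq> q" for x
    using depth_eq_0 that by fastforce
  have branch_1: "branch x = x" if "depth x = 1" for x
    using that by (simp add: branch_def)
  have "bistar T p q role parent"
  proof
    show "finite (pverts T)"
      by (rule pg.pair_finite_verts)
    show "p \<in> pverts T" "q \<in> pverts T"
      by (fact pV)+
    fix v assume v: "v \<in> pverts T"
    show "role v \<le> 5"
      using far_u[OF v] by (auto simp: role_def)
    show "role v = 2 \<longleftrightarrow> v = p"
      using pos[OF v] \<open>p \<noteq> q\<close> dp branch_1[of v] by (auto simp: role_def)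
    show "role v = 3 \<longleftrightarrow> v = q"
      using pos[OF v] by (auto simp: role_def)
    assume "v \<noteq> q"
    then show pv: "parent v \<in> pverts T"
      using parent_arc[OF v] pg.in_arcsD2 by blast
    show "role (parent v) = up_role (role v)"
    proof (cases "parent v = q")
      case True
      then have "depth v = 1"
        using depth_parent[OF v \<open>v \<noteq> q\<close>] by simp
      then show ?thesis
        using True \<open>v \<noteq> q\<close> by (auto simp: role_def up_role_def)
    next
      case False
      then show ?thesis
        using depth_parent[OF v \<open>v \<noteq> q\<close>] pos[OF pv] depth_3[OF v] branch_parent[OF v \<open>v \<noteq> q\<close>] \<open>v \<noteq> q\<close>
        by (auto simp: role_def up_role_def)
    qed
  next
    fix x y
    show "(x, y) \<in> parcs T \<longleftrightarrow> x \<in> pverts T \<and> y \<in> pverts T \<and>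
      (x \<noteq> q \<and> y = parent x \<or> y \<noteq> q \<and> x = parent y)"
      by (rule arc_iff_parent)
  next
    have "role u = 0"
      using du bu \<open>u \<noteq> q\<close> by (simp add: role_def)
    then show "\<exists>v\<in>pverts T. role v = 0"
      using V by blast
    have "role w = 5"
      using dw bw \<open>w \<noteq> q\<close> by (simp add: role_def)
    then show "\<exists>v\<in>pverts T. role v = 5"
      using V by blast
  qed
  then show "\<exists>role par. bistar T p q role par"
    by blast
qed

text \<open>Reading a longest path in both directions shows that its two middle vertices have
  eccentricity 3, the least possible, so they are the given central vertices.\<close>

lemma tree_diameter_5_bistar:
  assumes tree: "tree_graph T" and diam: "gdiameter T = 5"
    and "v1 \<noteq> v2" and central: "central_vertices T = {v1, v2}"
  shows "\<exists>role par. bistar T v1 v2 role par"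
proof -
  interpret pair_graph T
    using tree by (simp add: tree_graph_def)
  have sym: "sym (parcs T)"
    using arcs_symmetric by (auto intro: symI)
  have diam5: "\<exists>j\<le>5. (x, y) \<in> parcs T ^^ j" if "x \<in> pverts T" "y \<in> pverts T" for x y
    using gdiameter_le_iff[of 5] diam that by (simp add: numeral_eq_enat)
  have "\<not> gdiameter T \<le> enat 4"
    using diam by (simp add: numeral_eq_enat)
  then obtain u w where V: "u \<in> pverts T" "w \<in> pverts T"
    and "\<forall>j\<le>4. (u, w) \<notin> parcs T ^^ j"
    using gdiameter_le_iff[of 4] by blast
  then have far: "(u, w) \<notin> parcs T ^^ j" if "j < 5" for j
    using that by simp
  obtain j where j: "j \<le> 5" "(u, w) \<in> parcs T ^^ j"
    using diam5[OF V] by auto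
  \<comment> \<open>The sum is split so as to cut the path at its middle edge.\<close>
  then have "j = 2 + (1 + 2)"
    using far[of j] by (cases "j = 5") auto
  with j(2) have "(u, w) \<in> parcs T ^^ (2 + (1 + 2))"
    by simp
  then obtain p q where path: "(u, p) \<in> parcs T ^^ 2" "(p, q) \<in> parcs T" "(q, w) \<in> parcs T ^^ 2"
    unfolding relpow_add relpow_1 by blast
  have path': "(w, q) \<in> parcs T ^^ 2" "(q, p) \<in> parcs T" "(p, u) \<in> parcs T ^^ 2"
    using path sym relpow_sym[OF sym] by (auto dest: symD)
  have far': "(w, u) \<notin> parcs T ^^ j" if "j < 5" for j
    using far[OF that] relpow_sym[OF sym] by blast
  have pV: "p \<in> pverts T" "q \<in> pverts T" "p \<noteq> q"
    using path(2) in_arcsD1 in_arcsD2 no_loops' by auto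
  note right = diameter_5_bistar[OF tree diam5 path far V]
  note left = diameter_5_bistar[OF tree diam5 path' far' V(2,1)]
  \<comment> \<open>A vertex within distance 2 of both ends would bring \<open>u\<close> and
    \<open>w\<close> within distance 4.\<close>
  have lower: "3 \<le> eccentricity T x" if x: "x \<in> pverts T" for x
  proof (rule ccontr)
    assume "\<not> 3 \<le> eccentricity T x"
    then have "eccentricity T x < enat 3"
      by (simp add: numeral_eq_enat)
    then obtain e where "eccentricity T x = enat e" "e < 3"
      by (rule less_enatE)
    then have "eccentricity T x \<le> enat 2"
      by simp
    then obtain i j where ij: "i \<le> 2" "(x, u) \<in> parcs T ^^ i" "j \<le> 2" "(x, w) \<in> parcs T ^^ j"
      using eccentricity_le_iff[OF x] V by meson
    show False
      using far[of "i + j"] relpow_trans[OF relpow_sym[OF sym ij(2)] ij(4)] ij(1,3)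
      by simp
  qed
  have ecc: "eccentricity T p = 3" "eccentricity T q = 3"
  proof -
    have "eccentricity T p \<le> enat 3" "eccentricity T q \<le> enat 3"
      using left(1) right(1) relpow_sym[OF sym] pV by (simp_all add: eccentricity_le_iff) blast+
    then show "eccentricity T p = 3" "eccentricity T q = 3"
      using lower pV by (simp_all add: numeral_eq_enat order_antisym)
  qed
  have "gradius T = 3"
    unfolding gradius_def
    by (rule antisym) (use lower ecc pV in \<open>auto intro: INF_greatest INF_lower2\<close>)
  then have "{p, q} \<subseteq> central_vertices T"
    using ecc pV by (auto simp: central_vertices_def)
  then have "p = v1 \<and> q = v2 \<or> p = v2 \<and> q = v1"
    using central pV(3) by auto
  then show ?thesis
    using left(2) right(2) by blast
qed

section \<open>Short orientations of a vertex-multiplication\<close>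

lemma relpow_increase_le:
  fixes f :: "'b \<Rightarrow> nat"
  assumes "(x, y) \<in> r ^^ k" "\<And>a b. (a, b) \<in> r \<Longrightarrow> f b \<le> Suc (f a)"
  shows "f y \<le> f x + k"
  using assms(1)
proof (induction k arbitrary: y)
  case (Suc k)
  then obtain z where "(x, z) \<in> r ^^ k" "(z, y) \<in> r" by auto
  then show ?case
    using Suc.IH assms(2) by fastforce
qed simp

lemma orientation_of_vertex_mult_arc:
  assumes "orientation_of D (vertex_mult T s)" "(x, y) \<in> parcs D"
  shows "x \<in> pverts D" "y \<in> pverts D" "fst x \<noteq> fst y" "(fst x, fst y) \<in> parcs T"
  using assms by (auto simp: orientation_of_def vertex_mult_def Let_def)

lemma orientation_of_vertex_mult_verts:
  assumes "orientation_of D (vertex_mult T s)"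
  shows "x \<in> pverts D \<longleftrightarrow> fst x \<in> pverts T \<and> snd x < s (fst x)"
  using assms by (cases x) (auto simp: orientation_of_def vertex_mult_def Let_def)

lemma orientation_of_vertex_mult_wf:
  assumes "orientation_of D (vertex_mult T s)"
  shows "pair_wf_digraph D"
  using orientation_of_vertex_mult_arc[OF assms] by unfold_locales auto

definition all_within :: "'a pair_pre_digraph \<Rightarrow> nat \<Rightarrow> bool" where
  "all_within D k \<longleftrightarrow> (\<forall>x\<in>pverts D. \<forall>y\<in>pverts D. \<exists>j\<le>k. (x, y) \<in> parcs D ^^ j)"

lemma (in bistar) role_arc:
  assumes "(u, v) \<in> parcs T"
  shows "role v = Suc (role u) \<or> role u = Suc (role v)"
  using assms role_eq_3[of u] role_eq_3[of v] role_le[of u] role_le[of v] role_par[of u] role_par[of v]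
  by (auto simp: arc_iff up_role_def split: if_splits)

text \<open>Copies of roles 0 and 5 are at least 5 apart in every orientation, so only the upper
  bound is at stake. An orientation with all distances at most 5 is strong, and the infimum is
  attained.\<close>

lemma (in bistar) vm_class_0_iff:
  assumes diam: "gdiameter T = 5" and s: "\<And>v. v \<in> pverts T \<Longrightarrow> 2 \<le> s v"
  shows "vm_class 0 T s \<longleftrightarrow> (\<exists>D. orientation_of D (vertex_mult T s) \<and> all_within D 5)"
proof -
  let ?G = "vertex_mult T s"
  have le_iff: "gdiameter D \<le> enat k \<longleftrightarrow> all_within D k" if "orientation_of D ?G" for D k
    using pair_wf_digraph.gdiameter_le_iff[OF orientation_of_vertex_mult_wf[OF that]]
    by (simp add: all_within_def)
  obtain v w where vw: "v \<in> pverts T" "role v = 0" "w \<in> pverts T" "role w = 5"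
    using ex_role_0 ex_role_5 by blast
  have lower: "5 \<le> gdiameter D" if D: "orientation_of D ?G" for D
  proof (rule ccontr)
    assume "\<not> 5 \<le> gdiameter D"
    then have "gdiameter D < enat 5"
      by (simp add: numeral_eq_enat)
    then obtain e where "gdiameter D = enat e" "e < 5"
      by (rule less_enatE)
    then have "all_within D 4"
      using le_iff[OF D, of 4] by simp
    moreover have "(v, 0) \<in> pverts D" "(w, 0) \<in> pverts D"
      using orientation_of_vertex_mult_verts[OF D] s[of v] s[of w] vw by auto
    ultimately obtain j where j: "j \<le> 4" "((v, 0), (w, 0)) \<in> parcs D ^^ j"
      unfolding all_within_def by meson
    have "role (fst (w, 0 :: nat)) \<le> role (fst (v, 0 :: nat)) + j"
      using role_arc orientation_of_vertex_mult_arc(4)[OF D]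
      by (intro relpow_increase_le[OF j(2), where f = "\<lambda>x. role (fst x)"]) fastforce
    then show False
      using j(1) vw by simp
  qed
  have strong: "strongly_connected (with_proj D)" if D: "orientation_of D ?G" "all_within D 5" for D
  proof -
    interpret D: pair_wf_digraph D
      by (rule orientation_of_vertex_mult_wf[OF D(1)])
    have "(v, 0) \<in> pverts D"
      using orientation_of_vertex_mult_verts[OF D(1)] s[of v] vw by auto
    moreover have "reachable (with_proj D) x y" if xy: "x \<in> pverts D" "y \<in> pverts D" for x y
    proof -
      obtain j where "(x, y) \<in> parcs D ^^ j"
        using D(2) xy unfolding all_within_def by meson
      then show ?thesis
        using D.relpow_imp_awalk[OF _ xy(1)] D.reachable_awalkI by blast
    qed
    ultimately show ?thesis
      by (auto simp: strongly_connected_def)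
  qed
  let ?S = "{D. orientation_of D ?G \<and> strongly_connected (with_proj D)}"
  have "5 \<le> orientation_number ?G"
    unfolding orientation_number_def using lower by (auto intro: INF_greatest)
  then have "vm_class 0 T s \<longleftrightarrow> orientation_number ?G \<le> 5"
    using diam by (auto simp: vm_class_def zero_enat_def[symmetric])
  also have "\<dots> \<longleftrightarrow> (\<exists>D. orientation_of D ?G \<and> all_within D 5)"
  proof
    assume le: "orientation_number ?G \<le> 5"
    have "gdiameter ` ?S \<noteq> {}"
    proof
      assume "gdiameter ` ?S = {}"
      then have "orientation_number ?G = \<infinity>"
        unfolding orientation_number_def by (metis Inf_empty top_enat_def)
      then show False
        using le by simp
    qed
    then obtain d where "d \<in> gdiameter ` ?S"
      by auto
    then have "Inf (gdiameter ` ?S) \<in> gdiameter ` ?S"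
      by (rule wellorder_InfI)
    then obtain D where "D \<in> ?S" "gdiameter D \<le> enat 5"
      using le unfolding orientation_number_def by (auto simp: numeral_eq_enat)
    then show "\<exists>D. orientation_of D ?G \<and> all_within D 5"
      using le_iff by auto
  next
    assume "\<exists>D. orientation_of D ?G \<and> all_within D 5"
    then obtain D where D: "orientation_of D ?G" "all_within D 5"
      by blast
    then have "D \<in> ?S" "gdiameter D \<le> 5"
      using strong le_iff[of D 5] by (auto simp: numeral_eq_enat)
    then show "orientation_number ?G \<le> 5"
      unfolding orientation_number_def by (rule INF_lower2)
  qed
  finally show ?thesis .
qed

section \<open>Orientations from templates\<close>

text \<open>
  A template is a digraph on the nodes \<open>(r, c)\<close>, where \<open>r\<close> is a role and \<open>c\<close> a number below the
  number \<open>m ! r\<close> of classes of copies of a vertex of role \<open>r\<close>. \<open>U r c d\<close> says whether the edge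
  between \<open>(r, c)\<close> and \<open>(up_role r, d)\<close> is directed upwards.
\<close>

definition tstep :: "(nat \<Rightarrow> nat \<Rightarrow> nat \<Rightarrow> bool) \<Rightarrow> nat \<times> nat \<Rightarrow> nat \<times> nat \<Rightarrow> bool" where
  "tstep U x y \<longleftrightarrow>
     fst x \<noteq> 3 \<and> fst y = up_role (fst x) \<and> U (fst x) (snd x) (snd y) \<or>
     fst y \<noteq> 3 \<and> fst x = up_role (fst y) \<and> \<not> U (fst y) (snd y) (snd x)"

definition tnodes :: "nat list \<Rightarrow> (nat \<times> nat) list" where
  "tnodes m = concat (map (\<lambda>r. map (Pair r) [0..<m ! r]) [0..<6])"

definition tinner :: "nat list \<Rightarrow> (nat \<times> nat) list" where
  "tinner m = filter (\<lambda>x. 1 \<le> fst x \<and> fst x \<le> 4) (tnodes m)"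

text \<open>Search layers that do not discard nodes seen before: an entry \<open>(i, z)\<close>
  stands for a walk of exactly \<open>i - k\<close> steps from \<open>R\<close>, each step landing
  in \<open>N\<close>. Plain lists keep it executable.\<close>

fun treach :: "('b \<Rightarrow> 'b \<Rightarrow> bool) \<Rightarrow> 'b list \<Rightarrow> nat \<Rightarrow> nat \<Rightarrow> 'b list \<Rightarrow> (nat \<times> 'b) list" where
  "treach f N k 0 R = map (Pair k) R"
| "treach f N k (Suc n) R =
     map (Pair k) R @ treach f N (Suc k) n (filter (\<lambda>z. \<exists>y\<in>set R. f y z) N)"

definition tcentral :: "((nat \<times> nat) \<Rightarrow> (nat \<times> nat) \<Rightarrow> bool) \<Rightarrow> nat list \<Rightarrow> nat \<times> nat \<Rightarrow> (nat \<times> nat \<times> nat) list"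
  where "tcentral f m x = filter (\<lambda>(k, r, c). r = 2 \<or> r = 3) (treach f (tinner m) 0 3 [x])"

text \<open>Total length 0 is excluded because distinct vertices may lie over the same node.\<close>

definition tmeet :: "(nat \<times> nat \<times> nat) list \<Rightarrow> (nat \<times> nat \<times> nat) list \<Rightarrow> bool" where
  "tmeet F B \<longleftrightarrow> (\<exists>(j, h) \<in> set F. \<exists>(k, g) \<in> set B. h = g \<and> 1 \<le> j + k \<and> j + k \<le> 5)"

text \<open>
  Any two template nodes, except possibly two nodes of role 0, are connected by a walk of length
  between 1 and 5 through a central node. Walks through the centre lift to the vertex-multiplication
  because the first part only needs the ancestors of its start and the second part those of its end.
  Parts of length at most 3 suffice for the templates below.
\<close>

definition tcheck :: "bool \<Rightarrow> (nat \<Rightarrow> nat \<Rightarrow> nat \<Rightarrow> bool) \<Rightarrow> nat list \<Rightarrow> bool" where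
  "tcheck leaf_pairs U m \<longleftrightarrow>
     list_all (\<lambda>(r, F). list_all (\<lambda>(q, B). \<not> leaf_pairs \<and> r = 0 \<and> q = 0 \<or> tmeet F B)
         (map (\<lambda>y. (fst y, tcentral (\<lambda>a b. tstep U b a) m y)) (tnodes m)))
       (map (\<lambda>x. (fst x, tcentral (tstep U) m x)) (tnodes m))"

section \<open>Soundness of the finite check\<close>

lemma treach_sound:
  assumes "(j, z) \<in> set (treach f N k n R)"
  shows "\<exists>y\<in>set R. \<exists>i. j = k + i \<and> (y, z) \<in> {(a, b). f a b \<and> b \<in> set N} ^^ i"
  using assms
proof (induction n arbitrary: k R)
  case 0
  then show ?case by (auto intro!: bexI[of _ z] exI[of _ 0])
next
  case (Suc n)
  show ?case
  proof (cases "(j, z) \<in> set (map (Pair k) R)")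
    case True
    then show ?thesis by (auto intro!: bexI[of _ z] exI[of _ 0])
  next
    case False
    then have "(j, z) \<in> set (treach f N (Suc k) n (filter (\<lambda>z. \<exists>y\<in>set R. f y z) N))"
      using Suc.prems by simp
    from Suc.IH[OF this] obtain y w i where "w \<in> set R" "f w y" "y \<in> set N"
      "j = Suc k + i" "(y, z) \<in> {(a, b). f a b \<and> b \<in> set N} ^^ i"
      by auto
    then show ?thesis
      using relpow_Suc_I2[of w y "{(a, b). f a b \<and> b \<in> set N}" z i]
      by (intro bexI[of _ w] exI[of _ "Suc i"]) auto
  qed
qed

lemma relpow_converse_iff:
  fixes r :: "'b rel"
  shows "(x, y) \<in> (r\<inverse>) ^^ n \<longleftrightarrow> (y, x) \<in> r ^^ n"
proof (induction n arbitrary: x y)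
  case (Suc n)
  show ?case
  proof
    assume "(x, y) \<in> (r\<inverse>) ^^ Suc n"
    then obtain z where "(x, z) \<in> (r\<inverse>) ^^ n" "(y, z) \<in> r" by auto
    then show "(y, x) \<in> r ^^ Suc n"
      using Suc.IH relpow_Suc_I2 by metis
  next
    assume "(y, x) \<in> r ^^ Suc n"
    then obtain z where "(y, z) \<in> r" "(z, x) \<in> r ^^ n"
      by (metis relpow_Suc_D2)
    then show "(x, y) \<in> (r\<inverse>) ^^ Suc n"
      using Suc.IH by auto
  qed
qed auto

lemma tcheckD:
  assumes "tcheck lp U m" "x \<in> set (tnodes m)" "y \<in> set (tnodes m)" "lp \<or> fst x \<noteq> 0 \<or> fst y \<noteq> 0"
  shows "\<exists>h j k. (fst h = 2 \<or> fst h = 3) \<and> 1 \<le> j + k \<and> j + k \<le> 5 \<and>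
     (x, h) \<in> {(a, b). tstep U a b \<and> b \<in> set (tinner m)} ^^ j \<and>
     (y, h) \<in> {(a, b). tstep U b a \<and> b \<in> set (tinner m)} ^^ k"
proof -
  have "tmeet (tcentral (tstep U) m x) (tcentral (\<lambda>a b. tstep U b a) m y)"
    using assms unfolding tcheck_def list_all_iff by fastforce
  then obtain j k h where
    *: "(j, h) \<in> set (tcentral (tstep U) m x)" "(k, h) \<in> set (tcentral (\<lambda>a b. tstep U b a) m y)"
    "1 \<le> j + k" "j + k \<le> 5"
    unfolding tmeet_def by blast
  have "fst h = 2 \<or> fst h = 3"
    using *(1) by (auto simp: tcentral_def)
  moreover have "(x, h) \<in> {(a, b). tstep U a b \<and> b \<in> set (tinner m)} ^^ j"
    using *(1) treach_sound[of j h "tstep U" "tinner m" 0 3 "[x]"] by (auto simp: tcentral_def)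
  moreover have "(y, h) \<in> {(a, b). tstep U b a \<and> b \<in> set (tinner m)} ^^ k"
    using *(2) treach_sound[of k h "\<lambda>a b. tstep U b a" "tinner m" 0 3 "[y]"]
    by (auto simp: tcentral_def)
  ultimately show ?thesis
    using *(3,4) by blast
qed

lemma in_tnodes: "r < 6 \<Longrightarrow> c < m ! r \<Longrightarrow> (r, c) \<in> set (tnodes m)"
  by (auto simp: tnodes_def intro!: bexI[of _ r])

lemma tinnerD: "b \<in> set (tinner m) \<Longrightarrow> 1 \<le> fst b \<and> fst b \<le> 4 \<and> snd b < m ! fst b"
  by (auto simp: tinner_def tnodes_def)

section \<open>Lifting template walks to the vertex-multiplication\<close>

context bistar
begin

definition role_1_vertex :: 'a where
  "role_1_vertex = par (SOME v. v \<in> pverts T \<and> role v = 0)"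

definition role_4_vertex :: 'a where
  "role_4_vertex = par (SOME v. v \<in> pverts T \<and> role v = 5)"

text \<open>Only copies of these vertices occur inside the walks constructed below.\<close>

definition core :: "'a set" where
  "core = {c1, c2} \<union> par ` {v \<in> pverts T. role v = 0 \<or> role v = 5}"

text \<open>The vertex of role \<open>r\<close> used by a lifted walk that starts at
  \<open>v\<close>: the parent of \<open>v\<close> where \<open>v\<close> is an outer leaf next to
  that role, a fixed representative otherwise.\<close>

definition chain :: "'a \<Rightarrow> nat \<Rightarrow> 'a" where
  "chain v r = (if r = 2 then c1 else if r = 3 then c2
     else if r = 1 then (if role v = 0 then par v else role_1_vertex)
     else if role v = 5 then par v else role_4_vertex)"

lemma role_centre [simp]: "role c1 = 2" "role c2 = 3"
  using role_eq_2 role_eq_3 centre_in by auto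

lemma role_1_vertex: "role_1_vertex \<in> pverts T" "role_1_vertex \<in> core" "role role_1_vertex = 1"
proof -
  have "\<exists>v. v \<in> pverts T \<and> role v = 0"
    using ex_role_0 by blast
  note v = someI_ex[OF this]
  have "(SOME v. v \<in> pverts T \<and> role v = 0) \<noteq> c2"
  proof
    assume "(SOME v. v \<in> pverts T \<and> role v = 0) = c2"
    with v show False by simp
  qed
  then show "role_1_vertex \<in> pverts T" "role_1_vertex \<in> core" "role role_1_vertex = 1"
    using v par_in role_par by (auto simp: role_1_vertex_def core_def up_role_def)
qed

lemma role_4_vertex: "role_4_vertex \<in> pverts T" "role_4_vertex \<in> core" "role role_4_vertex = 4"
proof -
  have "\<exists>v. v \<in> pverts T \<and> role v = 5"
    using ex_role_5 by blast
  note v = someI_ex[OF this]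
  have "(SOME v. v \<in> pverts T \<and> role v = 5) \<noteq> c2"
  proof
    assume "(SOME v. v \<in> pverts T \<and> role v = 5) = c2"
    with v show False by simp
  qed
  then show "role_4_vertex \<in> pverts T" "role_4_vertex \<in> core" "role role_4_vertex = 4"
    using v par_in role_par by (auto simp: role_4_vertex_def core_def up_role_def)
qed

lemma par_centre:
  assumes "v \<in> pverts T"
  shows "role v = 1 \<Longrightarrow> par v = c1" "role v = 2 \<Longrightarrow> par v = c2" "role v = 4 \<Longrightarrow> par v = c2"
proof -
  have "v \<noteq> c2" if "role v \<noteq> 3"
    using that by auto
  then show "role v = 1 \<Longrightarrow> par v = c1" "role v = 2 \<Longrightarrow> par v = c2" "role v = 4 \<Longrightarrow> par v = c2"
    using role_par[OF assms] role_eq_2[of "par v"] role_eq_3[of "par v"] role_eq_3[OF assms] par_in[OF assms]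
    by (simp_all add: up_role_def)
qed

text \<open>Parents of vertices of role 1, 2 or 4 are central, and a central vertex is determined by
  its role.\<close>

lemma par_eq_if_role:
  assumes "u \<in> pverts T" "w \<in> pverts T" "role u \<in> {1, 2, 4}" "role w = up_role (role u)"
  shows "par u = w"
  using assms par_centre[OF assms(1)] role_eq_2[OF assms(2)] role_eq_3[OF assms(2)]
  by (auto simp: up_role_def)

lemma chain_props:
  assumes v: "v \<in> pverts T" and r: "r \<in> {1, 2, 3, 4}"
  shows "chain v r \<in> pverts T" "chain v r \<in> core" "role (chain v r) = r"
proof -
  have "par v \<in> pverts T" "role (par v) = up_role (role v)" if "role v \<noteq> 3"
    using par_in[OF v] role_par[OF v] role_eq_3[OF v] that by simp_all
  then show "chain v r \<in> pverts T" "chain v r \<in> core" "role (chain v r) = r"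
    using r v role_1_vertex role_4_vertex centre_in
    by (auto simp: chain_def core_def up_role_def)
qed

text \<open>All copies beyond the last class are merged into it, so one finite template serves all
  larger multiplicities.\<close>

definition node :: "nat list \<Rightarrow> 'a \<times> nat \<Rightarrow> nat \<times> nat" where
  "node m x = (role (fst x), min (snd x) (m ! role (fst x) - 1))"

definition template_orientation ::
    "('a \<Rightarrow> nat) \<Rightarrow> nat list \<Rightarrow> (nat \<Rightarrow> nat \<Rightarrow> nat \<Rightarrow> bool) \<Rightarrow> ('a \<times> nat) pair_pre_digraph" where
  "template_orientation s m U = \<lparr>pverts = pverts (vertex_mult T s),
     parcs = {(x, y) \<in> parcs (vertex_mult T s). tstep U (node m x) (node m y)}\<rparr>"

lemma vertex_mult_verts: "x \<in> pverts (vertex_mult T s) \<longleftrightarrow> fst x \<in> pverts T \<and> snd x < s (fst x)"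
  by (cases x) (auto simp: vertex_mult_def Let_def)

lemma no_loop: "(u, u) \<notin> parcs T"
  using role_arc[of u u] by auto

lemma vertex_mult_arcs:
  "(x, y) \<in> parcs (vertex_mult T s) \<longleftrightarrow>
     x \<in> pverts (vertex_mult T s) \<and> y \<in> pverts (vertex_mult T s) \<and> (fst x, fst y) \<in> parcs T"
  using no_loop by (cases x; cases y) (auto simp: vertex_mult_def Let_def)

text \<open>On each edge exactly one end is the lower one in the sense of \<open>up_role\<close>, so
  \<open>tstep\<close> selects exactly one direction.\<close>

lemma template_orientation: "orientation_of (template_orientation s m U) (vertex_mult T s)"
proof -
  have one: "tstep U (node m x) (node m y) \<noteq> tstep U (node m y) (node m x)"
    if "(x, y) \<in> parcs (vertex_mult T s)" for x y
  proof -
    have rx: "role (fst x) \<le> 5" and ry: "role (fst y) \<le> 5" and xy: "(fst x, fst y) \<in> parcs T"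
      using that role_le by (auto simp: vertex_mult_arcs vertex_mult_verts)
    have "role (fst x) \<noteq> 3 \<and> role (fst y) = up_role (role (fst x)) \<or>
      role (fst y) \<noteq> 3 \<and> role (fst x) = up_role (role (fst y))"
      using xy role_par role_eq_3 by (auto simp: arc_iff)
    moreover have "\<not> (role (fst x) \<noteq> 3 \<and> role (fst y) = up_role (role (fst x)) \<and>
      role (fst y) \<noteq> 3 \<and> role (fst x) = up_role (role (fst y)))"
      using rx ry by (auto simp: up_role_def split: if_splits)
    ultimately show ?thesis
      unfolding tstep_def node_def fst_conv snd_conv by argo
  qed
  have "(y, x) \<in> parcs (vertex_mult T s)" if "(x, y) \<in> parcs (vertex_mult T s)" for x y
    using that by (auto simp: vertex_mult_arcs arc_iff)
  then have "((x, y) \<in> parcs (template_orientation s m U)) \<noteq> ((y, x) \<in> parcs (template_orientation s m U))"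
    if "(x, y) \<in> parcs (vertex_mult T s)" for x y
    using one[OF that] that by (simp add: template_orientation_def)
  moreover have "pverts (template_orientation s m U) = pverts (vertex_mult T s)"
    "parcs (template_orientation s m U) \<subseteq> parcs (vertex_mult T s)"
    by (auto simp: template_orientation_def)
  ultimately show ?thesis
    unfolding orientation_of_def by blast
qed

text \<open>Every vertex after the start is placed on the \<open>chain\<close> of the start. The
  relation \<open>f\<close> is kept general so that both \<open>tstep\<close> and its converse can
  be lifted. The middle conjunct records that roles 0 and 5 occur only at the start.\<close>

lemma template_lift:
  assumes m: "\<And>v. v \<in> core \<Longrightarrow> m ! role v \<le> s v"
    and x: "x \<in> pverts (vertex_mult T s)"
    and adj: "\<And>a b. f a b \<Longrightarrow> fst a \<noteq> 3 \<and> fst b = up_role (fst a) \<or> fst b \<noteq> 3 \<and> fst a = up_role (fst b)"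
    and arc: "\<And>y z. (y, z) \<in> parcs (vertex_mult T s) \<Longrightarrow> f (node m y) (node m z) \<Longrightarrow> (y, z) \<in> E"
    and walk: "(node m x, h) \<in> {(a, b). f a b \<and> b \<in> set (tinner m)} ^^ k"
  shows "\<exists>y\<in>pverts (vertex_mult T s). node m y = h \<and> (y = x \<or> fst h \<in> {1, 2, 3, 4}) \<and> (x, y) \<in> E ^^ k"
  using walk
proof (induction k arbitrary: h)
  case 0
  then show ?case
    using x by auto
next
  case (Suc k)
  then obtain g where g: "(node m x, g) \<in> {(a, b). f a b \<and> b \<in> set (tinner m)} ^^ k"
    and gh: "f g h" "h \<in> set (tinner m)"
    by auto
  from Suc.IH[OF g] obtain y where y: "y \<in> pverts (vertex_mult T s)" "node m y = g"
    "y = x \<or> fst g \<in> {1, 2, 3, 4}" "(x, y) \<in> E ^^ k"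
    by blast
  let ?v = "fst x" and ?z = "(chain (fst x) (fst h), snd h)"
  have v: "?v \<in> pverts T" and y': "fst y \<in> pverts T" "role (fst y) = fst g"
    using x y by (auto simp: vertex_mult_verts node_def)
  have h: "fst h \<in> {1, 2, 3, 4}" "snd h < m ! fst h"
    using tinnerD[OF gh(2)] by auto
  note z = chain_props[OF v h(1)]
  have zV: "?z \<in> pverts (vertex_mult T s)"
    using m[OF z(2)] z h(2) by (simp add: vertex_mult_verts)
  have zh: "node m ?z = h"
    using z h(2) by (auto simp: node_def min_def prod_eq_iff)
  have "(fst y, chain ?v (fst h)) \<in> parcs T"
    using adj[OF gh(1)]
  proof
    assume *: "fst g \<noteq> 3 \<and> fst h = up_role (fst g)"
    then have "fst y \<noteq> c2"
      using y'(2) role_centre(2) by metis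
    moreover have "par (fst y) = chain ?v (fst h)"
    proof (cases "fst g \<in> {1, 2, 4}")
      case True
      then show ?thesis
        using par_eq_if_role[OF y'(1) z(1)] z(3) y'(2) * by simp
    next
      case False
      \<comment> \<open>From role 0 or 5 the walk must go to the parent of \<open>x\<close> itself,
        which is what \<open>chain\<close> provides.\<close>
      then have "y = x" "fst g = 0 \<or> fst g = 5"
        using y(3) y'(2) role_le[OF y'(1)] * by auto
      then show ?thesis
        using * y'(2) by (auto simp: chain_def up_role_def)
    qed
    ultimately show ?thesis
      using y'(1) z(1) by (auto simp: arc_iff)
  next
    assume *: "fst h \<noteq> 3 \<and> fst g = up_role (fst h)"
    then have "chain ?v (fst h) \<noteq> c2"
      using z(3) role_centre(2) by metis
    moreover have "par (chain ?v (fst h)) = fst y"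
      using par_eq_if_role[OF z(1) y'(1)] z(3) y'(2) * h(1) by simp
    ultimately show ?thesis
      using y'(1) z(1) by (auto simp: arc_iff)
  qed
  then have "(y, ?z) \<in> E"
    using arc[of y ?z] y(1,2) zV zh gh(1) by (simp add: vertex_mult_arcs)
  then show ?case
    using y(4) h(1) zV zh by (intro bexI[of _ ?z]) auto
qed

text \<open>The lifted forward and backward walks end in copies of one central vertex lying in the
  same class. Such copies have the same in- and out-neighbours, so the two walks can be
  glued.\<close>

lemma template_within_5:
  assumes m: "\<And>v. v \<in> core \<Longrightarrow> m ! role v \<le> s v" and pos: "\<And>r. r \<le> 5 \<Longrightarrow> 1 \<le> m ! r"
    and check: "tcheck lp U m"
    and x: "x \<in> pverts (vertex_mult T s)" and y: "y \<in> pverts (vertex_mult T s)"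
    and lp: "lp \<or> role (fst x) \<noteq> 0 \<or> role (fst y) \<noteq> 0"
  shows "\<exists>j\<le>5. (x, y) \<in> parcs (template_orientation s m U) ^^ j"
proof -
  let ?E = "parcs (template_orientation s m U)"
  have E: "(a, b) \<in> ?E \<longleftrightarrow> (a, b) \<in> parcs (vertex_mult T s) \<and> tstep U (node m a) (node m b)" for a b
    by (simp add: template_orientation_def)
  have sym: "(b, a) \<in> parcs (vertex_mult T s)" if "(a, b) \<in> parcs (vertex_mult T s)" for a b
    using that by (auto simp: vertex_mult_arcs arc_iff)
  have nodes: "node m z \<in> set (tnodes m)" if "z \<in> pverts (vertex_mult T s)" for z
    using that role_le[of "fst z"] pos[of "role (fst z)"]
    by (auto simp: node_def vertex_mult_verts intro!: in_tnodes)
  have "lp \<or> fst (node m x) \<noteq> 0 \<or> fst (node m y) \<noteq> 0"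
    using lp by (simp add: node_def)
  from tcheckD[OF check nodes[OF x] nodes[OF y] this] obtain h j k where
    h: "fst h = 2 \<or> fst h = 3" and jk: "1 \<le> j + k" "j + k \<le> 5"
    and fwd: "(node m x, h) \<in> {(a, b). tstep U a b \<and> b \<in> set (tinner m)} ^^ j"
    and bwd: "(node m y, h) \<in> {(a, b). tstep U b a \<and> b \<in> set (tinner m)} ^^ k"
    by blast
  obtain x' where x': "x' \<in> pverts (vertex_mult T s)" "node m x' = h" "(x, x') \<in> ?E ^^ j"
    using template_lift[OF m x _ _ fwd, where E = ?E] E unfolding tstep_def by blast
  obtain y' where y': "y' \<in> pverts (vertex_mult T s)" "node m y' = h" "(y, y') \<in> (?E\<inverse>) ^^ k"
    using template_lift[OF m y _ _ bwd, where E = "?E\<inverse>"] E sym unfolding tstep_def by blast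
  have y'y: "(y', y) \<in> ?E ^^ k"
    using y'(3) by (simp add: relpow_converse_iff)
  have "fst x' \<in> pverts T" "fst y' \<in> pverts T" "role (fst x') = fst h" "role (fst y') = fst h"
    using x' y' by (auto simp: vertex_mult_verts node_def)
  then have twins: "fst x' = fst y'" "node m x' = node m y'"
    using x'(2) y'(2) h role_eq_2 role_eq_3 by metis+
  have twin_out: "(x', z) \<in> ?E" if "(y', z) \<in> ?E" for z
    using that twins x'(1) by (auto simp: E vertex_mult_arcs)
  have twin_in: "(z, y') \<in> ?E" if "(z, x') \<in> ?E" for z
    using that twins y'(1) by (auto simp: E vertex_mult_arcs)
  \<comment> \<open>The last arc of the first part is redirected if the second part is empty;
    otherwise the first arc of the second part is. Positive total length guarantees such an
    arc.\<close>
  have "(x, y) \<in> ?E ^^ (j + k)"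
  proof (cases k)
    case 0
    then obtain i where "j = Suc i"
      using jk(1) by (cases j) auto
    then have "(x, y') \<in> ?E ^^ j"
      using x'(3) twin_in by auto
    then show ?thesis
      using 0 y'y by simp
  next
    case (Suc i)
    then obtain z where "(y', z) \<in> ?E" "(z, y) \<in> ?E ^^ i"
      using y'y relpow_Suc_D2 by metis
    then have "(x', y) \<in> ?E ^^ k"
      using twin_out Suc relpow_Suc_I2 by metis
    then show ?thesis
      using relpow_trans[OF x'(3)] by blast
  qed
  then show ?thesis
    using jk(2) by blast
qed

end

text \<open>
  The templates for \<open>s c1 \<ge> 3\<close>, for four copies of every vertex in \<open>NL T c1 c2\<close> and \<open>NL T c2 c1\<close>,
  and for a single vertex in \<open>NL T c1 c2\<close>. In the second one the copies of \<open>c1\<close> and \<open>c2\<close> form a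
  directed 4-cycle, and every leaf has among its in-neighbours and among its out-neighbours copies
  of either orientation towards the centre. In the third one two leaves with a common neighbour are
  joined without passing through the centre.
\<close>

definition up_arcs_3 :: "nat \<Rightarrow> nat \<Rightarrow> nat \<Rightarrow> bool" where
  "up_arcs_3 r i j = (if r = 0 \<or> r = 5 then j = 0 else if r = 1 then j = 0 \<or> i = 0 \<and> j = 1
     else if r = 2 then i = 0 \<and> j \<le> 1 \<or> i = 1 \<and> j = 0 else i = j)"

definition up_arcs_4 :: "nat \<Rightarrow> nat \<Rightarrow> nat \<Rightarrow> bool" where
  "up_arcs_4 r i j = (if r = 0 \<or> r = 5 then j < 2 else if r = 2 then i = j else i mod 2 = j)"

definition up_arcs_1 :: "nat \<Rightarrow> nat \<Rightarrow> nat \<Rightarrow> bool" where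
  "up_arcs_1 r i j = (if r = 0 \<or> r = 4 then i = j else if r = 2 then i = 0 else j = 0)"

lemma tcheck_up_arcs_3: "tcheck True up_arcs_3 [1, 2, 3, 2, 2, 1]"
  by code_simp

lemma tcheck_up_arcs_4: "tcheck True up_arcs_4 [1, 4, 2, 2, 4, 1]"
  by code_simp

lemma tcheck_up_arcs_1: "tcheck False up_arcs_1 [2, 2, 2, 2, 2, 1]"
  by code_simp

section \<open>Non-leaf neighbours of the centre and the sufficient conditions\<close>

context bistar
begin

lemma par_role_0: "v \<in> pverts T \<Longrightarrow> role v = 0 \<Longrightarrow> par v \<in> pverts T \<and> role (par v) = 1"
  using par_in[of v] role_par[of v] role_eq_3[of v] by (simp add: up_role_def)

lemma par_role_5: "v \<in> pverts T \<Longrightarrow> role v = 5 \<Longrightarrow> par v \<in> pverts T \<and> role (par v) = 4"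
  using par_in[of v] role_par[of v] role_eq_3[of v] by (simp add: up_role_def)

text \<open>The arc to the parent always leaves \<open>u\<close>, so degree 1 means that there is no
  child.\<close>

lemma end_vertex_iff:
  assumes "u \<in> pverts T" "u \<noteq> c2"
  shows "end_vertex T u \<longleftrightarrow> \<not> (\<exists>w\<in>pverts T. w \<noteq> c2 \<and> par w = u)"
proof -
  let ?A = "out_arcs (with_proj T) u"
  have A: "e \<in> ?A \<longleftrightarrow> e \<in> parcs T \<and> fst e = u" for e
    by (simp add: out_arcs_def)
  have up: "(u, par u) \<in> ?A"
    using assms par_in by (simp add: A arc_iff)
  have "card ?A = 1 \<longleftrightarrow> ?A = {(u, par u)}"
    using up by (metis card_1_singletonE is_singletonI is_singleton_altdef singletonD)
  also have "\<dots> \<longleftrightarrow> \<not> (\<exists>w\<in>pverts T. w \<noteq> c2 \<and> par w = u)"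
  proof
    assume only: "?A = {(u, par u)}"
    show "\<not> (\<exists>w\<in>pverts T. w \<noteq> c2 \<and> par w = u)"
    proof
      assume "\<exists>w\<in>pverts T. w \<noteq> c2 \<and> par w = u"
      then obtain w where w: "w \<in> pverts T" "w \<noteq> c2" "par w = u"
        by blast
      then have "(u, w) \<in> ?A"
        using assms by (auto simp: A arc_iff)
      then have "w = par u"
        using only by auto
      then show False
        using role_par[OF w(1,2)] role_par[OF assms] w role_eq_3[OF w(1)] role_eq_3[OF assms(1)] assms
        by (auto simp: up_role_def split: if_splits)
    qed
  next
    assume "\<not> (\<exists>w\<in>pverts T. w \<noteq> c2 \<and> par w = u)"
    then have "?A \<subseteq> {(u, par u)}"
      using assms by (auto simp: A arc_iff)
    then show "?A = {(u, par u)}"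
      using up by blast
  qed
  finally show ?thesis
    using assms by (simp add: end_vertex_def out_degree_def)
qed

lemma role_child_centre:
  assumes "w \<in> pverts T" "w \<noteq> c2"
  shows "role (par w) = 1 \<longleftrightarrow> role w = 0" "role (par w) = 4 \<longleftrightarrow> role w = 5"
  using role_par[OF assms] role_le[OF assms(1)] role_eq_3[OF assms(1)] assms(2)
  by (auto simp: up_role_def)

text \<open>A neighbour of \<open>c1\<close> other than \<open>c2\<close> has role 1, and it fails
  to be a leaf exactly when it has a child, necessarily of role 0.\<close>

lemma NL_c1: "NL T c1 c2 = par ` {v \<in> pverts T. role v = 0}"
proof (intro set_eqI iffI)
  fix u assume "u \<in> NL T c1 c2"
  then have u: "(c1, u) \<in> parcs T" "u \<noteq> c2" "\<not> end_vertex T u"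
    by (auto simp: NL_def)
  then have uV: "u \<in> pverts T" and "par u = c1"
    using par_eq_if_role[of c1 c2] centre_in by (auto simp: arc_iff up_role_def)
  then have "role u = 1"
    using role_par[OF uV u(2)] role_eq_3[OF uV] u(2) by (auto simp: up_role_def split: if_splits)
  then show "u \<in> par ` {v \<in> pverts T. role v = 0}"
    using end_vertex_iff[OF uV u(2)] u(3) role_child_centre(1) by auto
next
  fix u assume "u \<in> par ` {v \<in> pverts T. role v = 0}"
  then obtain v where v: "v \<in> pverts T" "role v = 0" "u = par v"
    by blast
  then have u: "u \<in> pverts T" "role u = 1"
    using par_role_0 by auto
  then have "u \<noteq> c2" "par u = c1" "v \<noteq> c2"
    using role_centre(2) par_centre(1) v(2) by auto
  then show "u \<in> NL T c1 c2"
    using end_vertex_iff[OF u(1)] u v centre_in by (auto simp: NL_def arc_iff)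
qed

lemma NL_c2: "NL T c2 c1 = par ` {v \<in> pverts T. role v = 5}"
proof (intro set_eqI iffI)
  fix u assume "u \<in> NL T c2 c1"
  then have u: "(c2, u) \<in> parcs T" "u \<noteq> c1" "\<not> end_vertex T u"
    by (auto simp: NL_def)
  then have uV: "u \<in> pverts T" and "par u = c2" "u \<noteq> c2"
    using no_loop by (auto simp: arc_iff)
  then have "role u = 4"
    using role_par[OF uV] role_eq_2[OF uV] u(2) by (auto simp: up_role_def split: if_splits)
  then show "u \<in> par ` {v \<in> pverts T. role v = 5}"
    using end_vertex_iff[OF uV \<open>u \<noteq> c2\<close>] u(3) role_child_centre(2) by auto
next
  fix u assume "u \<in> par ` {v \<in> pverts T. role v = 5}"
  then obtain v where v: "v \<in> pverts T" "role v = 5" "u = par v"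
    by blast
  then have u: "u \<in> pverts T" "role u = 4"
    using par_role_5 by auto
  then have "u \<noteq> c1" "u \<noteq> c2" "par u = c2" "v \<noteq> c2"
    using role_centre par_centre(3) v(2) by auto
  then show "u \<in> NL T c2 c1"
    using end_vertex_iff[OF u(1)] u v centre_in by (auto simp: NL_def arc_iff)
qed

lemma finite_NL: "finite (NL T c1 c2)" "finite (NL T c2 c1)"
  using finite_verts by (auto simp: NL_c1 NL_c2)

lemma NL_nonempty: "NL T c1 c2 \<noteq> {}" "NL T c2 c1 \<noteq> {}"
  using ex_role_0 ex_role_5 by (auto simp: NL_c1 NL_c2)

lemma coreE:
  assumes "v \<in> core"
  obtains "v = c1" | "v = c2" | "v \<in> NL T c1 c2" "role v = 1" | "v \<in> NL T c2 c1" "role v = 4"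
  using assms par_role_0 par_role_5 by (auto simp: core_def NL_c1 NL_c2)

lemma core_in: "v \<in> core \<Longrightarrow> v \<in> pverts T"
  using par_role_0 par_role_5 centre_in by (auto simp: core_def)

lemma ex_orientation_if_3:
  assumes s: "\<And>v. v \<in> pverts T \<Longrightarrow> 2 \<le> s v" and "3 \<le> s c1"
  shows "\<exists>D. orientation_of D (vertex_mult T s) \<and> all_within D 5"
proof -
  \<comment> \<open>Three classes occur only at role 2, that is, for \<open>c1\<close>.\<close>
  let ?m = "[1, 2, 3, 2, 2, 1] :: nat list"
  have "?m ! role v \<le> s v" if "v \<in> core" for v
    using that assms(2) s[OF core_in[OF that]] by (cases rule: coreE) auto
  moreover have "1 \<le> ?m ! r" if "r \<le> 5" for r
    using that by (auto simp: nth_Cons split: nat.split)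
  ultimately have "all_within (template_orientation s ?m up_arcs_3) 5"
    using template_within_5[OF _ _ tcheck_up_arcs_3, of s] template_orientation[of s ?m up_arcs_3]
    unfolding all_within_def orientation_of_def by auto
  then show ?thesis
    using template_orientation by blast
qed

lemma ex_orientation_if_4:
  assumes s: "\<And>v. v \<in> pverts T \<Longrightarrow> 2 \<le> s v"
    and "\<And>u. u \<in> NL T c1 c2 \<union> NL T c2 c1 \<Longrightarrow> 4 \<le> s u"
  shows "\<exists>D. orientation_of D (vertex_mult T s) \<and> all_within D 5"
proof -
  \<comment> \<open>Four classes occur only at roles 1 and 4, whose core vertices are those of the
    two \<open>NL\<close> sets.\<close>
  let ?m = "[1, 4, 2, 2, 4, 1] :: nat list"
  have "?m ! role v \<le> s v" if "v \<in> core" for v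
    using that assms(2)[of v] s[OF core_in[OF that]] by (cases rule: coreE) auto
  moreover have "1 \<le> ?m ! r" if "r \<le> 5" for r
    using that by (auto simp: nth_Cons split: nat.split)
  ultimately have "all_within (template_orientation s ?m up_arcs_4) 5"
    using template_within_5[OF _ _ tcheck_up_arcs_4, of s] template_orientation[of s ?m up_arcs_4]
    unfolding all_within_def orientation_of_def by auto
  then show ?thesis
    using template_orientation by blast
qed

text \<open>All vertices of role 0 hang on one vertex \<open>u\<close>. A copy in class
  \<open>i\<close> points to copy \<open>i\<close> of \<open>u\<close> and is reached from copy
  \<open>1 - i\<close>; this connects pairs of role 0, which the template check leaves open.\<close>

lemma ex_orientation_if_single:
  assumes s: "\<And>v. v \<in> pverts T \<Longrightarrow> 2 \<le> s v" and single: "card (NL T c1 c2) = 1"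
  shows "\<exists>D. orientation_of D (vertex_mult T s) \<and> all_within D 5"
proof -
  let ?m = "[2, 2, 2, 2, 2, 1] :: nat list"
  let ?D = "template_orientation s ?m up_arcs_1"
  obtain u where u: "NL T c1 c2 = {u}"
    using single by (auto simp: card_1_singleton_iff)
  have m: "?m ! role v \<le> s v" if "v \<in> core" for v
    using that s[OF core_in[OF that]] by (cases rule: coreE) auto
  have pos: "1 \<le> ?m ! r" if "r \<le> 5" for r
    using that by (auto simp: nth_Cons split: nat.split)
  have leaf: "par (fst x) = u \<and> (\<forall>i<2. (fst x, i) \<in> pverts (vertex_mult T s)
      \<and> (u, i) \<in> pverts (vertex_mult T s))" "role u = 1"
    if "x \<in> pverts (vertex_mult T s)" "role (fst x) = 0" for x
  proof -
    have "fst x \<in> pverts T"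
      using that by (simp add: vertex_mult_verts)
    moreover from this have "par (fst x) = u"
      using u NL_c1 that(2) by auto
    moreover have "u \<in> pverts T \<and> role u = 1"
      using calculation par_role_0[of "fst x"] that(2) by simp
    ultimately show "par (fst x) = u \<and> (\<forall>i<2. (fst x, i) \<in> pverts (vertex_mult T s)
      \<and> (u, i) \<in> pverts (vertex_mult T s))" "role u = 1"
      using s[of "fst x"] s[of u] by (auto simp: vertex_mult_verts)
  qed
  have node: "node ?m x = (0, min (snd x) 1)" if "role (fst x) = 0" for x
    using that by (simp add: node_def)
  have up: "(x, (u, min (snd x) 1)) \<in> parcs ?D" and down: "((u, 1 - min (snd x) 1), x) \<in> parcs ?D"
    if x: "x \<in> pverts (vertex_mult T s)" "role (fst x) = 0" for x
  proof -
    have "fst x \<noteq> c2"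
      using x(2) role_centre(2) by (metis zero_neq_numeral)
    then have "(x, (u, i)) \<in> parcs (vertex_mult T s)" "((u, i), x) \<in> parcs (vertex_mult T s)"
      if "i < 2" for i
      using leaf[OF x] x that by (auto simp: vertex_mult_arcs arc_iff vertex_mult_verts)
    moreover have "node ?m (u, i) = (1, i)" if "i < 2" for i
      using leaf(2)[OF x] that by (auto simp: node_def)
    moreover have "min (snd x) 1 \<noteq> 1 - min (snd x) 1"
      by arith
    ultimately show "(x, (u, min (snd x) 1)) \<in> parcs ?D" "((u, 1 - min (snd x) 1), x) \<in> parcs ?D"
      using node[OF x(2)] by (auto simp: template_orientation_def tstep_def up_arcs_1_def up_role_def)
  qed
  have leaves: "\<exists>j\<le>5. (x, y) \<in> parcs ?D ^^ j"
    if x: "x \<in> pverts (vertex_mult T s)" "role (fst x) = 0"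
    and y: "y \<in> pverts (vertex_mult T s)" "role (fst y) = 0" for x y
  proof (cases "min (snd x) 1 = min (snd y) 1")
    case True
    \<comment> \<open>For equal classes the walk detours through a copy of the same leaf in the
      other class, giving length 4.\<close>
    let ?z = "(fst x, 1 - min (snd x) 1)"
    have z: "?z \<in> pverts (vertex_mult T s)" "role (fst ?z) = 0"
      using leaf(1)[OF x] x(2) by auto
    have "min (snd ?z) 1 = 1 - min (snd x) 1" "1 - min (snd ?z) 1 = min (snd x) 1"
      by auto
    then have "(x, (u, min (snd x) 1)) \<in> parcs ?D" "((u, min (snd x) 1), ?z) \<in> parcs ?D"
      "(?z, (u, 1 - min (snd x) 1)) \<in> parcs ?D" "((u, 1 - min (snd x) 1), y) \<in> parcs ?D"
      using up[OF x] down[OF z] up[OF z] down[OF y] True by simp_all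
    then have "(x, y) \<in> parcs ?D ^^ Suc (Suc (Suc (Suc 0)))"
      by (intro relpow_Suc_I2) auto
    then show ?thesis
      by (intro exI[of _ "Suc (Suc (Suc (Suc 0)))"]) simp
  next
    case False
    then have "min (snd x) 1 = 1 - min (snd y) 1"
      by auto
    then have "(x, (u, min (snd x) 1)) \<in> parcs ?D" "((u, min (snd x) 1), y) \<in> parcs ?D"
      using up[OF x] down[OF y] by simp_all
    then have "(x, y) \<in> parcs ?D ^^ Suc (Suc 0)"
      by (intro relpow_Suc_I2) auto
    then show ?thesis
      by (intro exI[of _ "Suc (Suc 0)"]) simp
  qed
  have "\<exists>j\<le>5. (x, y) \<in> parcs ?D ^^ j"
    if xy: "x \<in> pverts (vertex_mult T s)" "y \<in> pverts (vertex_mult T s)" for x y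
  proof (cases "role (fst x) = 0 \<and> role (fst y) = 0")
    case True
    then show ?thesis
      using leaves xy by blast
  next
    case False
    then show ?thesis
      using template_within_5[OF m pos tcheck_up_arcs_1 xy] by blast
  qed
  then have "all_within ?D 5"
    by (simp add: all_within_def template_orientation_def)
  then show ?thesis
    using template_orientation by blast
qed

section \<open>Roles along walks of length at most 5\<close>

text \<open>Each step changes the role by 1, so the length is at least 4, and parity excludes 5;
  hence every step raises the role. A general \<open>E\<close> allows the converse relation too,
  which yields descending walks.\<close>

lemma climb_4:
  assumes E: "E \<subseteq> parcs (vertex_mult T s)" and walk: "(x, y) \<in> E ^^ j" "j \<le> 5"
    and role: "role (fst y) = role (fst x) + 4"
  shows "\<exists>a b c. (x, a) \<in> E \<and> (a, b) \<in> E \<and> (b, c) \<in> E \<and> (c, y) \<in> E \<and>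
    role (fst a) = role (fst x) + 1 \<and> role (fst b) = role (fst x) + 2 \<and> role (fst c) = role (fst x) + 3"
proof -
  have step: "role (fst b) = Suc (role (fst a)) \<or> role (fst a) = Suc (role (fst b))"
    if "(a, b) \<in> E" for a b
  proof (rule role_arc)
    show "(fst a, fst b) \<in> parcs T"
      using subsetD[OF E that] by (simp add: vertex_mult_arcs)
  qed
  have step_le: "role (fst b) \<le> Suc (role (fst a))" if "(a, b) \<in> E" for a b
    using step[OF that] by auto
  have "role (fst y) \<le> role (fst x) + j"
    using relpow_increase_le[OF walk(1), where f = "\<lambda>x. role (fst x)"] step_le by blast
  then have "j = 4 \<or> j = 5"
    using role walk(2) by auto
  moreover have "even (role (fst x) + role (fst y) + j)"
    using walk(1)
  proof (induction j arbitrary: y)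
    case (Suc j)
    then obtain z where z: "(x, z) \<in> E ^^ j" "(z, y) \<in> E" by auto
    then show ?case
      using Suc.IH[OF z(1)] step[OF z(2)] by auto
  qed simp
  ultimately have "j = Suc (Suc (Suc (Suc 0)))"
    using role by auto
  then obtain a b c where abc: "(x, a) \<in> E" "(a, b) \<in> E" "(b, c) \<in> E" "(c, y) \<in> E"
    using walk(1) by auto
  moreover have "role (fst a) = role (fst x) + 1 \<and> role (fst b) = role (fst x) + 2 \<and>
      role (fst c) = role (fst x) + 3"
    using step_le[OF abc(1)] step_le[OF abc(2)] step_le[OF abc(3)] step_le[OF abc(4)] role by simp
  ultimately show ?thesis
    by blast
qed

text \<open>Parity leaves lengths 2 and 4. Length 2 would give a common parent; in length 4 the
  first and third inner vertices are copies of the two distinct parents, so the middle one is a copy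
  of a central vertex.\<close>

lemma walk_between_leaves:
  assumes E: "E \<subseteq> parcs (vertex_mult T s)" and walk: "(x, y) \<in> E ^^ j" "j \<le> 5"
    and ends: "role (fst x) = r" "role (fst y) = r" "par (fst x) \<noteq> par (fst y)" and r: "r = 0 \<or> r = 5"
  shows "\<exists>a b c. (a, b) \<in> E \<and> (b, c) \<in> E \<and> role (fst a) = up_role r \<and>
    role (fst b) = up_role (up_role r) \<and> role (fst c) = up_role r"
proof -
  have adj: "(fst a, fst b) \<in> parcs T" "fst a \<in> pverts T" "fst b \<in> pverts T" if "(a, b) \<in> E" for a b
    using that E by (auto simp: vertex_mult_arcs vertex_mult_verts)
  have leaf: "par (fst a) = fst b \<and> role (fst b) = up_role r"
    if "(fst a, fst b) \<in> parcs T" "role (fst a) = r" for a b :: "'a \<times> nat"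
  proof -
    have V: "fst a \<in> pverts T" "fst b \<in> pverts T"
      using that(1) by (auto simp: arc_iff)
    then have "fst a \<noteq> c2" "\<not> (fst b \<noteq> c2 \<and> fst a = par (fst b))"
      using that(2) r role_eq_3[OF V(1)] role_eq_3[OF V(2)] role_par[OF V(2)] role_le[OF V(2)]
      by (auto simp: up_role_def split: if_splits)
    then show ?thesis
      using that V role_par[OF V(1)] by (auto simp: arc_iff)
  qed
  have sym: "(v, u) \<in> parcs T" if "(u, v) \<in> parcs T" for u v
    using that by (auto simp: arc_iff)
  have step: "role (fst b) = Suc (role (fst a)) \<or> role (fst a) = Suc (role (fst b))"
    if "(a, b) \<in> E" for a b
    using role_arc[OF adj(1)[OF that]] .
  have "even (role (fst x) + role (fst y) + j)"
    using walk(1)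
  proof (induction j arbitrary: y)
    case (Suc j)
    then obtain z where z: "(x, z) \<in> E ^^ j" "(z, y) \<in> E" by auto
    then show ?case
      using Suc.IH[OF z(1)] step[OF z(2)] by auto
  qed simp
  then have "even j"
    using ends by simp
  moreover have "j = 0 \<or> j = 1 \<or> j = 2 \<or> j = 3 \<or> j = 4 \<or> j = 5"
    using walk(2) by auto
  ultimately have "j = 0 \<or> j = Suc (Suc 0) \<or> j = Suc (Suc (Suc (Suc 0)))"
    by auto
  moreover have "j \<noteq> 0"
    using walk(1) ends(3) by (auto intro: ccontr)
  moreover have "j \<noteq> Suc (Suc 0)"
  proof
    assume "j = Suc (Suc 0)"
    then obtain z where "(x, z) \<in> E" "(z, y) \<in> E"
      using walk(1) by auto
    then show False
      using leaf[OF adj(1)] leaf[OF sym[OF adj(1)]] ends by metis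
  qed
  ultimately obtain a b c where abc: "(x, a) \<in> E" "(a, b) \<in> E" "(b, c) \<in> E" "(c, y) \<in> E"
    using walk(1) by auto
  have a: "par (fst x) = fst a" "role (fst a) = up_role r"
    using leaf[OF adj(1)[OF abc(1)] ends(1)] by auto
  have c: "par (fst y) = fst c" "role (fst c) = up_role r"
    using leaf[OF sym[OF adj(1)[OF abc(4)]] ends(2)] by auto
  \<comment> \<open>A leaf in the middle would have both parents as its own.\<close>
  have "role (fst b) \<noteq> r"
    using leaf[OF sym[OF adj(1)[OF abc(2)]]] leaf[OF adj(1)[OF abc(3)]] a c ends(3) by metis
  then have "role (fst b) = up_role (up_role r)"
    using step[OF abc(2)] a(2) r role_le[OF adj(3)[OF abc(2)]] by (auto simp: up_role_def)
  then show ?thesis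
    using abc a c by blast
qed

end

section \<open>Two copies of each central vertex\<close>

context bistar
begin

text \<open>The pairs \<open>x\<close>, \<open>x'\<close> and \<open>z\<close>, \<open>z'\<close>
  witness two branching vertices on either side. The four copies of \<open>par t\<close> found at
  the end are told apart by their direction towards \<open>t\<close> and by the copy of
  \<open>c2\<close> they are joined to.\<close>

lemma four_copies:
  assumes s1: "s c1 = 2" and s2: "s c2 = 2" and s: "\<And>v. v \<in> pverts T \<Longrightarrow> 2 \<le> s v"
    and D: "orientation_of D (vertex_mult T s)" "all_within D 5"
    and x: "x \<in> pverts T" "x' \<in> pverts T" "role x = 0" "role x' = 0" "par x \<noteq> par x'"
    and z: "z \<in> pverts T" "z' \<in> pverts T" "role z = 5" "role z' = 5" "par z \<noteq> par z'"
    and t: "t \<in> pverts T" "role t = 5"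
  shows "4 \<le> s (par t)"
proof -
  let ?E = "parcs D"
  have verts: "a \<in> pverts D \<longleftrightarrow> fst a \<in> pverts T \<and> snd a < s (fst a)" for a
    using orientation_of_vertex_mult_verts[OF D(1)] .
  have sub: "?E \<subseteq> parcs (vertex_mult T s)" and sub': "?E\<inverse> \<subseteq> parcs (vertex_mult T s)"
    using D(1) by (auto simp: orientation_of_def vertex_mult_arcs arc_iff)
  have asym: "(b, a) \<notin> ?E" if "(a, b) \<in> ?E" for a b
    using D(1) that sub by (auto simp: orientation_of_def)
  have adj: "a \<in> pverts D" "b \<in> pverts D" "(fst a, fst b) \<in> parcs T" if "(a, b) \<in> ?E" for a b
    using orientation_of_vertex_mult_arc[OF D(1) that] by auto
  have walk: "\<exists>j\<le>5. (a, b) \<in> ?E ^^ j" if "a \<in> pverts D" "b \<in> pverts D" for a b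
    using D(2) that unfolding all_within_def by blast
  have walk': "\<exists>j\<le>5. (a, b) \<in> (?E\<inverse>) ^^ j" if "a \<in> pverts D" "b \<in> pverts D" for a b
    using walk[OF that(2,1)] by (simp add: relpow_converse_iff)
  have leaf_nbr: "u = par w" if "(u, w) \<in> parcs T" "role u = 4" "role w = 5" for u w
    using that role_par[of u] role_eq_3[of u] by (auto simp: arc_iff up_role_def)
  have c: "fst a = c1" if "a \<in> pverts D" "role (fst a) = 2" for a
    using that role_eq_2 by (simp add: verts)
  have c': "fst a = c2" if "a \<in> pverts D" "role (fst a) = 3" for a
    using that role_eq_3 by (simp add: verts)
  \<comment> \<open>Roles 1 and 5 differ by 4, so walks between such copies are monotone and pass
    through the centre; \<open>down_1\<close> is the same for the converse relation.\<close>
  have up_1: "\<exists>a b w. (p, a) \<in> ?E \<and> (a, b) \<in> ?E \<and> (b, w) \<in> ?E \<and> (w, q) \<in> ?E \<and>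
      fst a = c1 \<and> fst b = c2 \<and> fst w = par (fst q)"
    if pq: "p \<in> pverts D" "role (fst p) = 1" "q \<in> pverts D" "role (fst q) = 5" for p q
  proof -
    obtain j where j: "j \<le> 5" "(p, q) \<in> ?E ^^ j"
      using walk[OF pq(1,3)] by blast
    have "role (fst q) = role (fst p) + 4"
      using pq by simp
    from climb_4[OF sub j(2,1) this] obtain a b w where *: "(p, a) \<in> ?E" "(a, b) \<in> ?E" "(b, w) \<in> ?E" "(w, q) \<in> ?E"
      and r: "role (fst a) = 2" "role (fst b) = 3" "role (fst w) = 4"
      using pq(2) by auto
    show ?thesis
      using * c[OF adj(1)[OF *(2)] r(1)] c'[OF adj(1)[OF *(3)] r(2)]
        leaf_nbr[OF adj(3)[OF *(4)] r(3) pq(4)] by blast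
  qed
  have down_1: "\<exists>a b w. (a, p) \<in> ?E \<and> (b, a) \<in> ?E \<and> (w, b) \<in> ?E \<and> (q, w) \<in> ?E \<and>
      fst a = c1 \<and> fst b = c2 \<and> fst w = par (fst q)"
    if pq: "p \<in> pverts D" "role (fst p) = 1" "q \<in> pverts D" "role (fst q) = 5" for p q
  proof -
    obtain j where j: "j \<le> 5" "(p, q) \<in> (?E\<inverse>) ^^ j"
      using walk'[OF pq(1,3)] by blast
    have "role (fst q) = role (fst p) + 4"
      using pq by simp
    from climb_4[OF sub' j(2,1) this] obtain a b w where *: "(a, p) \<in> ?E" "(b, a) \<in> ?E" "(w, b) \<in> ?E" "(q, w) \<in> ?E"
      and r: "role (fst a) = 2" "role (fst b) = 3" "role (fst w) = 4"
      using pq(2) by auto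
    have "(fst w, fst q) \<in> parcs T"
      using adj(3)[OF *(4)] by (auto simp: arc_iff)
    then show ?thesis
      using * c[OF adj(2)[OF *(2)] r(1)] c'[OF adj(2)[OF *(3)] r(2)]
        leaf_nbr[OF _ r(3) pq(4)] by blast
  qed
  \<comment> \<open>Here the monotone walk starts at a copy of the role 0 vertex
    \<open>x\<close>.\<close>
  have up_0: "\<exists>a b. (a, b) \<in> ?E \<and> (b, q) \<in> ?E \<and> fst a = c1 \<and> fst b = c2"
    if pq: "q \<in> pverts D" "role (fst q) = 4" for q
  proof -
    have p: "(x, 0) \<in> pverts D"
      using x(1) s[OF x(1)] by (simp add: verts)
    obtain j where j: "j \<le> 5" "((x, 0), q) \<in> ?E ^^ j"
      using walk[OF p pq(1)] by blast
    have "role (fst q) = role (fst (x, 0 :: nat)) + 4"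
      using pq x(3) by simp
    from climb_4[OF sub j(2,1) this] obtain a b where *: "(a, b) \<in> ?E" "(b, q) \<in> ?E"
      and r: "role (fst a) = 2" "role (fst b) = 3"
      using x(3) by auto
    show ?thesis
      using * c[OF adj(1)[OF *(1)] r(1)] c'[OF adj(1)[OF *(2)] r(2)] by blast
  qed
  have down_0: "\<exists>a b. (b, a) \<in> ?E \<and> (q, b) \<in> ?E \<and> fst a = c1 \<and> fst b = c2"
    if pq: "q \<in> pverts D" "role (fst q) = 4" for q
  proof -
    have p: "(x, 0) \<in> pverts D"
      using x(1) s[OF x(1)] by (simp add: verts)
    obtain j where j: "j \<le> 5" "((x, 0), q) \<in> (?E\<inverse>) ^^ j"
      using walk'[OF p pq(1)] by blast
    have "role (fst q) = role (fst (x, 0 :: nat)) + 4"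
      using pq x(3) by simp
    from climb_4[OF sub' j(2,1) this] obtain a b where *: "(b, a) \<in> ?E" "(q, b) \<in> ?E"
      and r: "role (fst a) = 2" "role (fst b) = 3"
      using x(3) by auto
    show ?thesis
      using * c[OF adj(2)[OF *(1)] r(1)] c'[OF adj(2)[OF *(2)] r(2)] by blast
  qed
  have t0: "(t, 0) \<in> pverts D" "role (fst (t, 0 :: nat)) = 5"
    using t s[OF t(1)] by (auto simp: verts)
  \<comment> \<open>A central vertex has just two copies, so two copies that differ from a third one
    coincide.\<close>
  have two: "a = b" if "a \<in> pverts D" "b \<in> pverts D" "d \<in> pverts D" "a \<noteq> d" "b \<noteq> d"
      "fst a = u" "fst b = u" "fst d = u" "u = c1 \<or> u = c2" for a b d u
  proof -
    have "snd a < 2" "snd b < 2" "snd d < 2"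
      using that s1 s2 verts by auto
    then show ?thesis
      using that by (auto simp: prod_eq_iff)
  qed
  \<comment> \<open>One copy of \<open>c1\<close> must be an in-neighbour of \<open>p\<close>, which
    leaves only one possible out-neighbour. The next three facts use the same argument.\<close>
  have out_1: "a = b" if h: "(p, a) \<in> ?E" "(p, b) \<in> ?E" "role (fst p) = 1" "fst a = c1" "fst b = c1" for a b p
  proof -
    obtain d where "(d, p) \<in> ?E" "fst d = c1"
      using down_1[OF adj(1)[OF h(1)] h(3) t0] by blast
    then show ?thesis
      using two[of a b d c1] adj asym h by metis
  qed
  have in_1: "a = b" if h: "(a, p) \<in> ?E" "(b, p) \<in> ?E" "role (fst p) = 1" "fst a = c1" "fst b = c1" for a b p
  proof -
    obtain d where "(p, d) \<in> ?E" "fst d = c1"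
      using up_1[OF adj(2)[OF h(1)] h(3) t0] by blast
    then show ?thesis
      using two[of a b d c1] adj asym h by metis
  qed
  have out_4: "a = b" if h: "(p, a) \<in> ?E" "(p, b) \<in> ?E" "role (fst p) = 4" "fst a = c2" "fst b = c2" for a b p
  proof -
    obtain d where "(d, p) \<in> ?E" "fst d = c2"
      using up_0[OF adj(1)[OF h(1)] h(3)] by blast
    then show ?thesis
      using two[of a b d c2] adj asym h by metis
  qed
  have in_4: "a = b" if h: "(a, p) \<in> ?E" "(b, p) \<in> ?E" "role (fst p) = 4" "fst a = c2" "fst b = c2" for a b p
  proof -
    obtain d where "(p, d) \<in> ?E" "fst d = c2"
      using down_0[OF adj(2)[OF h(1)] h(3)] by blast
    then show ?thesis
      using two[of a b d c2] adj asym h by metis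
  qed
  have x0: "(x, 0) \<in> pverts D" "(x', 0) \<in> pverts D"
    using x s by (auto simp: verts) (metis less_le_trans zero_less_numeral)+
  have z0: "(z, 0) \<in> pverts D" "(z', 0) \<in> pverts D"
    using z s by (auto simp: verts) (metis less_le_trans zero_less_numeral)+
  \<comment> \<open>A walk between leaves with different parents supplies a copy of
    \<open>c1\<close> entered from one copy of role 1 and left towards another, so both orientations
    occur.\<close>
  obtain p a p' where p: "(p, a) \<in> ?E" "(a, p') \<in> ?E" "role (fst p) = 1" "role (fst a) = 2" "role (fst p') = 1"
  proof -
    obtain j where j: "j \<le> 5" "((x, 0), (x', 0)) \<in> ?E ^^ j"
      using walk[OF x0] by blast
    from walk_between_leaves[OF sub j(2,1), of 0] show ?thesis
      using x that by (auto simp: up_role_def)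
  qed
  obtain q b q' where q: "(q, b) \<in> ?E" "(b, q') \<in> ?E" "role (fst q) = 4" "role (fst b) = 3" "role (fst q') = 4"
  proof -
    obtain j where j: "j \<le> 5" "((z, 0), (z', 0)) \<in> ?E ^^ j"
      using walk[OF z0] by blast
    from walk_between_leaves[OF sub j(2,1), of 5] show ?thesis
      using z that by (auto simp: up_role_def)
  qed
  have a: "fst a = c1" "a \<in> pverts D" and b: "fst b = c2" "b \<in> pverts D"
    using c c' adj(2)[OF p(1)] adj(2)[OF q(1)] p(4) q(4) by auto
  have pV: "p \<in> pverts D" "p' \<in> pverts D" and qV: "q \<in> pverts D" "q' \<in> pverts D"
    using adj p q by blast+
  text \<open>Every copy of role 1 has one out-neighbour and one in-neighbour among the two copies of
    \<open>c1\<close>, and likewise for role 4 and \<open>c2\<close>; so the copies of \<open>c1\<close> and \<open>c2\<close> form a directed 4-cycle.\<close>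
  obtain b1 where ab: "(a, b1) \<in> ?E" "fst b1 = c2"
    using up_1[OF pV(1) p(3) t0] out_1 p a by metis
  obtain b2 where ba: "(b2, a) \<in> ?E" "fst b2 = c2"
    using down_1[OF pV(2) p(5) t0] in_1 p a by metis
  obtain a1 where pa1: "(a1, p) \<in> ?E" "fst a1 = c1" and ba1: "\<exists>b. (b, a1) \<in> ?E \<and> fst b = c2"
    using down_1[OF pV(1) p(3) t0] by blast
  obtain a2 where pa2: "(p', a2) \<in> ?E" "fst a2 = c1" and ab2: "\<exists>b. (a2, b) \<in> ?E \<and> fst b = c2"
    using up_1[OF pV(2) p(5) t0] by blast
  have "a1 \<noteq> a" "a2 \<noteq> a"
    using asym p pa1 pa2 by metis+
  then have "a2 = a1"
    using two[of a2 a1 a c1] pa1 pa2 a adj by metis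
  \<comment> \<open>For \<open>b\<close> itself, \<open>q'\<close> is entered only from
    \<open>b\<close> and \<open>q\<close> leads only to \<open>b\<close>. The other copy of
    \<open>c2\<close> is the in-neighbour of \<open>q\<close> and the out-neighbour of
    \<open>q'\<close>.\<close>
  have b_in_out: "(\<exists>d. (d, e) \<in> ?E \<and> fst d = c1) \<and> (\<exists>d. (e, d) \<in> ?E \<and> fst d = c1)"
    if e: "e \<in> pverts D" "fst e = c2" for e
  proof (cases "e = b")
    case True
    then show ?thesis
      using up_0[OF qV(2) q(5)] down_0[OF qV(1) q(3)] in_4[of _ q' b] out_4[of q _ b] q b by metis
  next
    case False
    obtain d f where d: "(d, q) \<in> ?E" "fst d = c2" "(f, d) \<in> ?E" "fst f = c1"
      using up_0[OF qV(1) q(3)] by blast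
    obtain d' f' where d': "(q', d') \<in> ?E" "fst d' = c2" "(d', f') \<in> ?E" "fst f' = c1"
      using down_0[OF qV(2) q(5)] by blast
    have "d \<noteq> b" "d' \<noteq> b"
      using asym q d d' by metis+
    then have "d = e" "d' = e"
      using two[of d e b c2] two[of d' e b c2] False e b d d' adj by metis+
    then show ?thesis
      using d d' by blast
  qed
  have b1V: "b1 \<in> pverts D" and b2V: "b2 \<in> pverts D" and a1V: "a1 \<in> pverts D"
    using adj ab ba pa1 by blast+
  have "b1 \<noteq> b2"
    using asym ab ba by metis+
  \<comment> \<open>This arc and the next one close the cycle from \<open>a\<close> through
    \<open>b1\<close>, \<open>a1\<close>, \<open>b2\<close> back to \<open>a\<close>.\<close>
  have b1a1: "(b1, a1) \<in> ?E"
  proof -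
    obtain d where d: "(b1, d) \<in> ?E" "fst d = c1"
      using b_in_out[OF b1V ab(2)] by blast
    then have "d \<noteq> a"
      using asym ab by metis+
    then show ?thesis
      using two[of d a1 a c1] \<open>a1 \<noteq> a\<close> d pa1 a adj by metis
  qed
  have a1b2: "(a1, b2) \<in> ?E"
  proof -
    obtain d where d: "(a1, d) \<in> ?E" "fst d = c2"
      using ab2 \<open>a2 = a1\<close> by blast
    then have "d \<noteq> b1"
      using asym b1a1 by metis+
    then show ?thesis
      using two[of d b2 b1 c2] \<open>b1 \<noteq> b2\<close> d ba ab b1V adj by metis
  qed
  have out_a: "d = b1" if "(a, d) \<in> ?E" "fst d = c2" for d
    using two[of d b1 b2 c2] that asym ba ab \<open>b1 \<noteq> b2\<close> b1V b2V adj by metis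
  have out_a1: "d = b2" if "(a1, d) \<in> ?E" "fst d = c2" for d
    using two[of d b2 b1 c2] that asym ba ab b1a1 \<open>b1 \<noteq> b2\<close> b1V b2V adj by metis
  have in_a1: "d = b1" if "(d, a1) \<in> ?E" "fst d = c2" for d
    using two[of d b1 b2 c2] that asym ba ab a1b2 \<open>b1 \<noteq> b2\<close> b1V b2V adj by metis
  have in_a: "d = b2" if "(d, a) \<in> ?E" "fst d = c2" for d
    using two[of d b2 b1 c2] that asym ba ab \<open>b1 \<noteq> b2\<close> b1V b2V adj by metis
  \<comment> \<open>Walks from \<open>p\<close> and \<open>p'\<close> to the leaf are forced through
    \<open>b1\<close> and \<open>b2\<close>, respectively; the walks from the leaf back to
    \<open>p\<close> and \<open>p'\<close> likewise.\<close>
  obtain w1 where w1: "(b1, w1) \<in> ?E" "(w1, (t, 0)) \<in> ?E" "fst w1 = par t"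
    using up_1[OF pV(1) p(3) t0] out_1[of p _ a] out_a p(1,3) a(1) by (metis fst_conv)
  obtain w2 where w2: "(b2, w2) \<in> ?E" "(w2, (t, 0)) \<in> ?E" "fst w2 = par t"
    using up_1[OF pV(2) p(5) t0] out_1[of p' _ a1] out_a1 p(5) pa2 \<open>a2 = a1\<close> by (metis fst_conv)
  obtain w3 where w3: "(w3, b1) \<in> ?E" "((t, 0), w3) \<in> ?E" "fst w3 = par t"
    using down_1[OF pV(1) p(3) t0] in_1[of _ p a1] in_a1 p(3) pa1 by (metis fst_conv)
  obtain w4 where w4: "(w4, b2) \<in> ?E" "((t, 0), w4) \<in> ?E" "fst w4 = par t"
    using down_1[OF pV(2) p(5) t0] in_1[of _ p' a] in_a p(2,5) a(1) by (metis fst_conv)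
  have "role (par t) = 4"
    using par_role_5 t by blast
  \<comment> \<open>A copy of role 4 has only one in-neighbour and only one out-neighbour among the
    copies of \<open>c2\<close>.\<close>
  then have "w1 \<noteq> w2" "w3 \<noteq> w4"
    using in_4[of b1 w1 b2] out_4[of w3 b1 b2] w1 w2 w3 w4 ab(2) ba(2) \<open>b1 \<noteq> b2\<close> by auto
  moreover have "w1 \<noteq> w3" "w1 \<noteq> w4" "w2 \<noteq> w3" "w2 \<noteq> w4"
    using asym w1 w2 w3 w4 by metis+
  ultimately have "card {snd w1, snd w2, snd w3, snd w4} = 4"
    using w1(3) w2(3) w3(3) w4(3) by (simp add: prod_eq_iff)
  moreover have "{snd w1, snd w2, snd w3, snd w4} \<subseteq> {..<s (par t)}"
    using adj(1)[OF w1(2)] adj(1)[OF w2(2)] adj(2)[OF w3(2)] adj(2)[OF w4(2)] w1(3) w2(3) w3(3) w4(3)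
    by (simp add: verts)
  ultimately show ?thesis
    using card_mono[of "{..<s (par t)}" "{snd w1, snd w2, snd w3, snd w4}"] by simp
qed

text \<open>A nonempty set whose cardinality is not 1 has two elements, which supplies the leaves
  for \<open>four_copies\<close>. The other side follows by exchanging the centres.\<close>

lemma four_le_NL_c2:
  assumes s1: "s c1 = 2" and s2: "s c2 = 2" and s: "\<And>v. v \<in> pverts T \<Longrightarrow> 2 \<le> s v"
    and D: "orientation_of D (vertex_mult T s)" "all_within D 5"
    and card: "card (NL T c1 c2) \<noteq> 1" "card (NL T c2 c1) \<noteq> 1"
    and u: "u \<in> NL T c2 c1"
  shows "4 \<le> s u"
proof -
  have "\<exists>a b. a \<in> A \<and> b \<in> A \<and> a \<noteq> b" if "card A \<noteq> 1" "A \<noteq> {}" for A :: "'a set"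
    using that by (metis card_1_singleton_iff equals0I insertI1 is_singletonI' is_singleton_def One_nat_def)
  from this[OF card(1) NL_nonempty(1)] this[OF card(2) NL_nonempty(2)]
  obtain x x' z z' where "x \<in> pverts T" "x' \<in> pverts T" "role x = 0" "role x' = 0" "par x \<noteq> par x'"
    "z \<in> pverts T" "z' \<in> pverts T" "role z = 5" "role z' = 5" "par z \<noteq> par z'"
    unfolding NL_c1 NL_c2 by auto
  moreover obtain t where "t \<in> pverts T" "role t = 5" "u = par t"
    using u by (auto simp: NL_c2)
  ultimately show ?thesis
    using four_copies[OF s1 s2 s D] by metis
qed

end

theorem theorem2p6:
  fixes T :: "'a pair_pre_digraph" and s :: "'a \<Rightarrow> nat" and v1 v2 :: 'a
  assumes "tree_graph T"
    and "gdiameter T = 5"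
    and "v1 \<noteq> v2"
    and "central_vertices T = {v1, v2}"
    and "\<And>v. v \<in> pverts T \<Longrightarrow> 2 \<le> s v"
  shows "(3 \<le> s v1 \<or> 3 \<le> s v2 \<longrightarrow> vm_class 0 T s) \<and>
    (4 \<le> min_mult T s v1 v2 \<and> 4 \<le> min_mult T s v2 v1 \<longrightarrow> vm_class 0 T s) \<and>
    (s v1 = 2 \<and> s v2 = 2 \<and>
       (2 \<le> min_mult T s v1 v2 \<and> min_mult T s v1 v2 \<le> 3 \<or>
        2 \<le> min_mult T s v2 v1 \<and> min_mult T s v2 v1 \<le> 3) \<longrightarrow>
     (vm_class 0 T s \<longleftrightarrow> card (NL T v1 v2) = 1 \<or> card (NL T v2 v1) = 1))"
proof -
  obtain role par where B: "bistar T v1 v2 role par"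
    using tree_diameter_5_bistar[OF assms(1-4)] by blast
  \<comment> \<open>The structure is needed for both orders of the centres, as several results above
    treat one side only.\<close>
  obtain role' par' where B': "bistar T v2 v1 role' par'"
    using tree_diameter_5_bistar[OF assms(1,2) assms(3)[symmetric]] assms(4) by (metis insert_commute)
  interpret L: bistar T v1 v2 role par by (rule B)
  interpret R: bistar T v2 v1 role' par' by (rule B')
  note s = assms(5)
  note iff = L.vm_class_0_iff[where s = s, OF assms(2) s]
  have min_mult: "4 \<le> min_mult T s v1 v2 \<longleftrightarrow> (\<forall>u\<in>NL T v1 v2. 4 \<le> s u)"
    "4 \<le> min_mult T s v2 v1 \<longleftrightarrow> (\<forall>u\<in>NL T v2 v1. 4 \<le> s u)"
    using L.finite_NL L.NL_nonempty by (simp_all add: min_mult_def)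
  show ?thesis
  proof (intro conjI impI)
    assume "3 \<le> s v1 \<or> 3 \<le> s v2"
    then show "vm_class 0 T s"
      using L.ex_orientation_if_3[where s = s, OF s] R.ex_orientation_if_3[where s = s, OF s] iff by blast
  next
    assume "4 \<le> min_mult T s v1 v2 \<and> 4 \<le> min_mult T s v2 v1"
    then show "vm_class 0 T s"
      using L.ex_orientation_if_4[where s = s, OF s] iff min_mult by blast
  next
    assume *: "s v1 = 2 \<and> s v2 = 2 \<and> (2 \<le> min_mult T s v1 v2 \<and> min_mult T s v1 v2 \<le> 3 \<or>
        2 \<le> min_mult T s v2 v1 \<and> min_mult T s v2 v1 \<le> 3)"
    show "vm_class 0 T s \<longleftrightarrow> card (NL T v1 v2) = 1 \<or> card (NL T v2 v1) = 1"
    proof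
      assume "card (NL T v1 v2) = 1 \<or> card (NL T v2 v1) = 1"
      then show "vm_class 0 T s"
        using L.ex_orientation_if_single[where s = s, OF s] R.ex_orientation_if_single[where s = s, OF s] iff by blast
    next
      assume "vm_class 0 T s"
      then obtain D where D: "orientation_of D (vertex_mult T s)" "all_within D 5"
        using iff by blast
      show "card (NL T v1 v2) = 1 \<or> card (NL T v2 v1) = 1"
      proof (rule ccontr)
        assume "\<not> ?thesis"
        \<comment> \<open>With two elements in each \<open>NL\<close> set both minima would be at
          least 4, whereas one of them is assumed to be at most 3.\<close>
        then have "4 \<le> min_mult T s v1 v2" "4 \<le> min_mult T s v2 v1"
          using L.four_le_NL_c2[where s = s, OF _ _ s D] R.four_le_NL_c2[where s = s, OF _ _ s D] * min_mult by auto
        then show False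
          using * by auto
      qed
    qed
  qed
qed

end
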